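(* Let $j\in\mathbb C$. Any rational function equivalent to $\mathcal L_j$ has the form $\mathcal L_{j'}$ for some $j'\in\mathbb C$. Furthermore, the set of $j'\in\mathbb C$ such that $\mathcal L_{j'}\sim\mathcal L_j$ coincides with the orbit of $j$ under the correspondence associated with the classical modular equation $\Phi_2(x,y)=0$.
   Context: Rational functions have complex coefficients and are viewed as maps $\mathbb{CP}^1\to\mathbb{CP}^1$. For a rational function $A$ and any decomposition $A=U\circ V$ with $U,V$ rational functions (degree-one factors are allowed), $\widetilde A=V\circ U$ is called an elementary transformation of $A$. Rational functions $A$ and $B$ are equivalent, $A\sim B$, if there is a finite chain of elementary transformations between $A$ and $B$. Conjugate rational functions (i.e. conjugate by a Möbius transformation) are equivalent. For $j\in\mathbb C$, $\mathcal L_j$ denotes any flexible Lattès map induced by multiplication by 2 on an elliptic curve with $j$-invariant $j$: that is, any rational function $\mathcal L$ for which there exist an elliptic curve $\mathcal C$ over $\mathbb C$ with $j$-invariant $j$ and a morphism $\pi:\mathcal C\to\mathbb{CP}^1$ of degree two with $\pi(z)=\pi(-z)$ such that $\mathcal L\circ\pi(z)=\pi(2z)$. (Equivalently, up to conjugacy, $\wp(2z)=\mathcal L\circ\wp(z)$ where $\wp$ is the Weierstrass function of a lattice $M$ with $\mathcal C\cong\mathbb C/M$.) Such a map is determined by $j$ up to conjugacy. The correspondence associated with an affine algebraic curve $F(x,y)=0$: an image of $x_0\in\mathbb C$ is any $y_0\in\mathbb C$ with $F(x_0,y_0)=0$; $y_0$ is an image of $x_0$ under the $k$-th iteration if there is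 a sequence $x_0,x_1,\dots,x_k=y_0$ in $\mathbb C$ with $F(x_{i-1},x_i)=0$ for $i=1,\dots,k$. If $F(x,y)=F(y,x)$, the orbit of $x_0$ is the set of all images of $x_0$ under all iterations (forward, backward and full orbits coincide). The classical modular polynomial $\Phi_2$ (whose zero set consists of the pairs $(j_1,j_2)$ of $j$-invariants of elliptic curves between which there is an isogeny with cyclic kernel of order 2) is given by the symmetric equation $$\Phi_2(x,y)=-x^2y^2+x^3+y^3+2^4\cdot 3\cdot 31\,xy(x+y)+3^4\cdot 5^3\cdot 4027\,xy-2^4\cdot 3^4\cdot 5^3(x^2+y^2)+2^8\cdot 3^7\cdot 5^6(x+y)-2^{12}\cdot 3^9\cdot 5^9=0.$$ *)

theory Defs
  imports Complex_Main "HOL-Computational_Algebra.Computational_Algebra"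
begin

section \<open>Rational functions as self-maps of the projective line\<close>

datatype cp1 = Fin complex | Infty

text \<open>The point \<open>[u : v]\<close> of the projective line. The value at \<open>u = v = 0\<close> is junk; every use
  below excludes this case.\<close>

definition cp1_of :: "complex \<Rightarrow> complex \<Rightarrow> cp1" where
  "cp1_of u v = (if v = 0 then Infty else Fin (u / v))"

text \<open>The map given by \<open>p / q\<close>, for \<open>p\<close> and \<open>q\<close> coprime: both are homogenised to the degree
  \<open>max (degree p) (degree q)\<close>, so their values at \<open>[1 : 0]\<close> are the coefficients at that degree.\<close>

fun rat_map :: "complex poly \<Rightarrow> complex poly \<Rightarrow> cp1 \<Rightarrow> cp1" where
  "rat_map p q (Fin z) = cp1_of (poly p z) (poly q z)"
| "rat_map p q Infty =
     (let d = max (degree p) (degree q) in cp1_of (coeff p d) (coeff q d))"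

definition rational_function :: "(cp1 \<Rightarrow> cp1) \<Rightarrow> bool" where
  "rational_function R \<longleftrightarrow> (\<exists>p q. q \<noteq> 0 \<and> coprime p q \<and> R = rat_map p q)"

text \<open>Rationality of both compositions has to be demanded only because of constants: if \<open>V\<close> is
  constantly a pole of \<open>U\<close>, then \<open>U \<circ> V\<close> is the constant \<open>Infty\<close>, which is not a rational function.\<close>

definition elementary_transformation :: "(cp1 \<Rightarrow> cp1) \<Rightarrow> (cp1 \<Rightarrow> cp1) \<Rightarrow> bool" where
  "elementary_transformation A B \<longleftrightarrow>
     rational_function A \<and> rational_function B \<and>
     (\<exists>U V. rational_function U \<and> rational_function V \<and> A = U \<circ> V \<and> B = V \<circ> U)"

definition equivalent_rat :: "(cp1 \<Rightarrow> cp1) \<Rightarrow> (cp1 \<Rightarrow> cp1) \<Rightarrow> bool" (infix "\<sim>\<^sub>r" 50) where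
  "A \<sim>\<^sub>r B \<longleftrightarrow>
     rational_function A \<and> rational_function B \<and> elementary_transformation\<^sup>*\<^sup>* A B"


section \<open>Elliptic curves over the complex numbers\<close>

text \<open>Elliptic curves are given by short Weierstrass equations \<open>y\<^sup>2 = x\<^sup>3 + a x + b\<close>, and every
  elliptic curve over the complex numbers is isomorphic to one of these. A curve is the projective
  closure in the plane, whose only point at infinity \<open>[0 : 1 : 0]\<close> is the origin \<open>Origin\<close> of the
  group law.\<close>

definition elliptic_curve :: "complex \<Rightarrow> complex \<Rightarrow> bool" where
  "elliptic_curve a b \<longleftrightarrow> 4 * a ^ 3 + 27 * b ^ 2 \<noteq> 0"

definition j_invariant :: "complex \<Rightarrow> complex \<Rightarrow> complex" where
  "j_invariant a b = 1728 * (4 * a ^ 3) / (4 * a ^ 3 + 27 * b ^ 2)"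

datatype epoint = Origin | Aff complex complex

definition curve :: "complex \<Rightarrow> complex \<Rightarrow> epoint set" where
  "curve a b = insert Origin {Aff x y | x y. y ^ 2 = x ^ 3 + a * x + b}"

fun ell_neg :: "epoint \<Rightarrow> epoint" where
  "ell_neg Origin = Origin"
| "ell_neg (Aff x y) = Aff x (- y)"

text \<open>The chord-and-tangent law on \<open>curve a b\<close>; the coefficient \<open>b\<close> does not occur in the formulas.\<close>

fun ell_add :: "complex \<Rightarrow> epoint \<Rightarrow> epoint \<Rightarrow> epoint" where
  "ell_add a Origin Q = Q"
| "ell_add a (Aff x1 y1) Origin = Aff x1 y1"
| "ell_add a (Aff x1 y1) (Aff x2 y2) =
     (if x1 = x2 \<and> y1 = - y2 then Origin
      else let m = (if x1 = x2 then (3 * x1 ^ 2 + a) / (2 * y1) else (y2 - y1) / (x2 - x1));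
               x3 = m ^ 2 - x1 - x2
           in Aff x3 (m * (x1 - x3) - y1))"


section \<open>Morphisms from an elliptic curve to the projective line\<close>

text \<open>The value at a point of the plane of the form of degree \<open>d\<close> in \<open>X, Y, Z\<close> in which \<open>c i k\<close> is
  the coefficient of \<open>X\<^sup>i Y\<^sup>k Z\<^bsup>d - i - k\<^esup>\<close>, in the homogeneous coordinates \<open>(x, y, 1)\<close> of \<open>Aff x y\<close>
  and \<open>(0, 1, 0)\<close> of \<open>Origin\<close>.\<close>

definition form_value ::
  "nat \<Rightarrow> (nat \<Rightarrow> nat \<Rightarrow> complex) \<Rightarrow> complex \<Rightarrow> complex \<Rightarrow> complex \<Rightarrow> complex" where
  "form_value d c X Y Z = (\<Sum>i\<le>d. \<Sum>k\<le>d - i. c i k * X ^ i * Y ^ k * Z ^ (d - i - k))"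

fun form_at :: "nat \<Rightarrow> (nat \<Rightarrow> nat \<Rightarrow> complex) \<Rightarrow> epoint \<Rightarrow> complex" where
  "form_at d c Origin = form_value d c 0 1 0"
| "form_at d c (Aff x y) = form_value d c x y 1"

text \<open>A morphism is a map that near each point is given as \<open>[F : G]\<close> by two forms of the same
  degree. As the curve is irreducible, such a formula is then valid wherever \<open>F\<close> and \<open>G\<close>
  do not both vanish.\<close>

definition morphism_to_cp1 :: "complex \<Rightarrow> complex \<Rightarrow> (epoint \<Rightarrow> cp1) \<Rightarrow> bool" where
  "morphism_to_cp1 a b \<pi> \<longleftrightarrow>
     (\<forall>P\<in>curve a b. \<exists>d F G.
        (form_at d F P \<noteq> 0 \<or> form_at d G P \<noteq> 0) \<and>
        (\<forall>Q\<in>curve a b. form_at d F Q \<noteq> 0 \<or> form_at d G Q \<noteq> 0 \<longrightarrow>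
           \<pi> Q = cp1_of (form_at d F Q) (form_at d G Q)))"

text \<open>The degree as the number of preimages of a generic point.\<close>

definition has_degree :: "complex \<Rightarrow> complex \<Rightarrow> (epoint \<Rightarrow> cp1) \<Rightarrow> nat \<Rightarrow> bool" where
  "has_degree a b \<pi> n \<longleftrightarrow>
     finite {w. \<not> (finite {P \<in> curve a b. \<pi> P = w} \<and> card {P \<in> curve a b. \<pi> P = w} = n)}"


section \<open>Flexible Lattes maps induced by multiplication by 2\<close>

definition lattes_map :: "complex \<Rightarrow> (cp1 \<Rightarrow> cp1) \<Rightarrow> bool" where
  "lattes_map j L \<longleftrightarrow>
     rational_function L \<and>
     (\<exists>a b \<pi>. elliptic_curve a b \<and> j_invariant a b = j \<and>
        morphism_to_cp1 a b \<pi> \<and> has_degree a b \<pi> 2 \<and>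
        (\<forall>P\<in>curve a b. \<pi> (ell_neg P) = \<pi> P) \<and>
        (\<forall>P\<in>curve a b. L (\<pi> P) = \<pi> (ell_add a P P)))"


section \<open>Correspondences and the modular polynomial\<close>

definition iterated_image ::
  "(complex \<Rightarrow> complex \<Rightarrow> complex) \<Rightarrow> nat \<Rightarrow> complex \<Rightarrow> complex \<Rightarrow> bool" where
  "iterated_image F k x0 y0 \<longleftrightarrow>
     (\<exists>x :: nat \<Rightarrow> complex. x 0 = x0 \<and> x k = y0 \<and> (\<forall>i\<in>{1..k}. F (x (i - 1)) (x i) = 0))"

definition orbit :: "(complex \<Rightarrow> complex \<Rightarrow> complex) \<Rightarrow> complex \<Rightarrow> complex set" where
  "orbit F x0 = {y0. \<exists>k\<ge>1. iterated_image F k x0 y0}"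

definition Phi2 :: "complex \<Rightarrow> complex \<Rightarrow> complex" where
  "Phi2 x y =
     - (x ^ 2 * y ^ 2) + x ^ 3 + y ^ 3
     + 2 ^ 4 * 3 * 31 * x * y * (x + y)
     + 3 ^ 4 * 5 ^ 3 * 4027 * x * y
     - 2 ^ 4 * 3 ^ 4 * 5 ^ 3 * (x ^ 2 + y ^ 2)
     + 2 ^ 8 * 3 ^ 7 * 5 ^ 6 * (x + y)
     - 2 ^ 12 * 3 ^ 9 * 5 ^ 9"

end

theory Submission
  imports Defs "HOL-Computational_Algebra.Field_as_Ring"
begin

text \<open>
  Evenness and degree two force \<open>\<pi>\<close> to be the x-coordinate followed by a Moebius transformation:
  on the curve every form of \<open>x, y\<close> is \<open>A(x) + y B(x)\<close>, an even quotient of two such functions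
  depends on \<open>x\<close> alone, and the resulting map of the line must have degree one because the
  x-coordinate already has degree two (\<open>even_morphism_factors\<close>, \<open>generic_fibre_x_coord\<close>). Hence the
  Lattes maps of \<open>j\<close> are exactly the Moebius conjugates of the explicit quartic maps
  \<open>doubling a b\<close> of curves with that invariant. Curves with equal invariant differ by a scaling, so all
  Lattes maps of one \<open>j\<close> are conjugate (\<open>lattes_maps_same_j\<close>). Conversely the map determines \<open>j\<close>: among
  the fixed points of a doubling map only the image of the origin has multiplier 4 (in the coordinate
  \<open>1/x\<close>), the others have multiplier \<open>-2\<close>, so a conjugacy of two doubling maps fixes \<open>\<infinity>\<close>; it is then
  affine and carries the x-coordinates of the 2-torsion points of one curve to those of the other
  (\<open>conjugacy_fixes_Infty\<close>, \<open>conjugate_doublings_j_invariant\<close>).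

  Doubling is a 2-isogeny followed by its dual. If \<open>e\<close> is a root of the cubic, Velu's formula gives the
  isogeny \<open>x + t/(x - e)\<close> on x-coordinates, and interchanging the isogeny and its dual turns the
  doubling map of the curve into that of the isogenous curve (\<open>doubling_factor\<close>). The point is that
  there are no other decompositions (\<open>doubling_decomposition\<close>). In \<open>doubling a b = U \<circ> V\<close> the degrees
  multiply to 4. A factor of degree one only conjugates. If both degrees are 2, then \<open>V\<close> identifies
  \<open>\<infinity>\<close> with another point of its fibre; that point is a 2-torsion coordinate \<open>e\<close>, since \<open>doubling a b\<close>
  sends it to \<open>\<infinity>\<close>. After a Moebius transformation \<open>V\<close> is \<open>x + s/(x - e)\<close>, and comparing the leading
  behaviour at \<open>\<infinity>\<close> of \<open>doubling a b\<close> before and after the deck involution of \<open>V\<close> yields \<open>s = t\<close>.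
  So an elementary transformation either keeps \<open>j\<close> or replaces it by the invariant of a 2-isogenous
  curve.

  In terms of \<open>h = (3 e\<^sup>2 + 4 a) / (3 e\<^sup>2 + a)\<close> the two invariants are \<open>256 (h - 1)\<^sup>3 / h\<close> and
  \<open>16 (16 - h)\<^sup>3 / h\<^sup>2\<close>. These functions parametrize the curve \<open>Phi2 = 0\<close>, and every nonzero \<open>h\<close> comes
  from some curve and root (\<open>Phi2_eq_0_iff\<close>, \<open>curve_with_parameter\<close>). Therefore chains of elementary
  transformations between Lattes maps correspond to paths of the correspondence \<open>Phi2 = 0\<close>.
\<close>

section \<open>Morphisms of the projective line in homogeneous coordinates\<close>

definition hom_eval :: "nat \<Rightarrow> complex poly \<Rightarrow> complex \<Rightarrow> complex \<Rightarrow> complex" where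
  "hom_eval d p u v = (\<Sum>i\<le>d. coeff p i * u ^ i * v ^ (d - i))"

fun hom_map :: "nat \<Rightarrow> complex poly \<Rightarrow> complex poly \<Rightarrow> cp1 \<Rightarrow> cp1" where
  "hom_map d p q (Fin z) = cp1_of (poly p z) (poly q z)"
| "hom_map d p q Infty = cp1_of (coeff p d) (coeff q d)"

definition no_common_zero :: "nat \<Rightarrow> complex poly \<Rightarrow> complex poly \<Rightarrow> bool" where
  "no_common_zero d p q \<longleftrightarrow> degree p \<le> d \<and> degree q \<le> d \<and>
     (\<forall>z. poly p z \<noteq> 0 \<or> poly q z \<noteq> 0) \<and> (coeff p d \<noteq> 0 \<or> coeff q d \<noteq> 0)"

text \<open>Self-maps of the line given by two forms of degree \<open>d\<close> without common zero. In contrast to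
  \<open>rational_function\<close> this includes the constant \<open>Infty\<close>, which makes the class closed under
  composition, and it carries the degree along.\<close>

definition morphism :: "nat \<Rightarrow> (cp1 \<Rightarrow> cp1) \<Rightarrow> bool" where
  "morphism d R \<longleftrightarrow> (\<exists>p q. no_common_zero d p q \<and> R = hom_map d p q)"

lemma cp1_of_scale: "k \<noteq> 0 \<Longrightarrow> cp1_of (k * u) (k * v) = cp1_of u v"
  by (simp add: cp1_of_def)

lemma cp1_of_eq_iff:
  assumes "u \<noteq> 0 \<or> v \<noteq> 0" "u' \<noteq> 0 \<or> v' \<noteq> 0"
  shows "cp1_of u v = cp1_of u' v' \<longleftrightarrow> u * v' = u' * v"
  using assms by (auto simp: cp1_of_def field_simps)

lemma hom_eval_1: "degree p \<le> d \<Longrightarrow> hom_eval d p z 1 = poly p z"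
  unfolding hom_eval_def poly_altdef
  by (rule sum.mono_neutral_cong_right) (auto intro: coeff_eq_0)

lemma hom_eval_scale: "hom_eval d p (k * u) (k * v) = k ^ d * hom_eval d p u v"
  unfolding hom_eval_def sum_distrib_left
proof (rule sum.cong)
  fix i assume "i \<in> {..d}"
  hence "k ^ d = k ^ i * k ^ (d - i)" by (simp flip: power_add)
  thus "coeff p i * (k * u) ^ i * (k * v) ^ (d - i) = k ^ d * (coeff p i * u ^ i * v ^ (d - i))"
    by (simp add: power_mult_distrib algebra_simps)
qed simp

lemma hom_eval_0: "hom_eval d p u 0 = coeff p d * u ^ d"
proof -
  have "hom_eval d p u 0 = (\<Sum>i\<in>{d}. coeff p i * u ^ i * 0 ^ (d - i))"
    unfolding hom_eval_def by (rule sum.mono_neutral_right) auto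
  thus ?thesis by simp
qed

lemma hom_eval_quotient:
  assumes "degree p \<le> d" "v \<noteq> 0"
  shows "hom_eval d p u v = v ^ d * poly p (u / v)"
  using hom_eval_scale[of d p v "u / v" 1] assms by (simp add: hom_eval_1)

lemma hom_map_cp1_of:
  assumes "degree p \<le> d" "degree q \<le> d" "u \<noteq> 0 \<or> v \<noteq> 0"
  shows "hom_map d p q (cp1_of u v) = cp1_of (hom_eval d p u v) (hom_eval d q u v)"
proof (cases "v = 0")
  case True
  thus ?thesis using assms(3) cp1_of_scale[of "u ^ d"]
    by (simp add: cp1_of_def[of u 0] hom_eval_0 mult.commute[of _ "u ^ d"])
next
  case False
  thus ?thesis using assms
    by (simp add: cp1_of_def[of u v] hom_eval_quotient cp1_of_scale)
qed

lemma hom_eval_nonzero: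
  assumes "no_common_zero d p q" "u \<noteq> 0 \<or> v \<noteq> 0"
  shows "hom_eval d p u v \<noteq> 0 \<or> hom_eval d q u v \<noteq> 0"
  using assms
  by (cases "v = 0") (auto simp: no_common_zero_def hom_eval_0 hom_eval_quotient)

definition hom_subst :: "nat \<Rightarrow> complex poly \<Rightarrow> complex poly \<Rightarrow> complex poly \<Rightarrow> complex poly" where
  "hom_subst d p r s = (\<Sum>i\<le>d. smult (coeff p i) (r ^ i * s ^ (d - i)))"

lemma poly_hom_subst: "poly (hom_subst d p r s) z = hom_eval d p (poly r z) (poly s z)"
  by (simp add: hom_subst_def hom_eval_def poly_sum mult.assoc)

lemma coeff_mult_bound:
  fixes r s :: "complex poly"
  assumes "degree r \<le> m" "degree s \<le> n"
  shows "coeff (r * s) (m + n) = coeff r m * coeff s n"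
proof (cases "degree r = m \<and> degree s = n")
  case True
  thus ?thesis using coeff_mult_degree_sum[of r s] by simp
next
  case False
  hence "degree r + degree s < m + n" using assms by linarith
  hence "degree (r * s) < m + n" using degree_mult_le[of r s] by linarith
  thus ?thesis using False assms by (auto simp: coeff_eq_0 le_less)
qed

lemma coeff_power_bound:
  fixes r :: "complex poly"
  assumes "degree r \<le> m"
  shows "degree (r ^ i) \<le> m * i \<and> coeff (r ^ i) (m * i) = coeff r m ^ i"
proof (induction i)
  case (Suc i)
  have "coeff (r * r ^ i) (m + m * i) = coeff r m * coeff (r ^ i) (m * i)"
    using assms Suc by (intro coeff_mult_bound) auto
  moreover have "degree (r * r ^ i) \<le> m + m * i"
    using assms Suc degree_mult_le[of r "r ^ i"] by linarith
  ultimately show ?case using Suc by simp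
qed simp

lemma coeff_hom_subst:
  assumes "degree r \<le> m" "degree s \<le> m"
  shows "degree (hom_subst d p r s) \<le> d * m"
    and "coeff (hom_subst d p r s) (d * m) = hom_eval d p (coeff r m) (coeff s m)"
proof -
  have *: "degree (r ^ i * s ^ (d - i)) \<le> d * m"
    "coeff (r ^ i * s ^ (d - i)) (d * m) = coeff r m ^ i * coeff s m ^ (d - i)" if "i \<le> d" for i
  proof -
    have dm: "d * m = m * i + m * (d - i)" using that
      by (metis add_mult_distrib2 le_add_diff_inverse mult.commute)
    show "coeff (r ^ i * s ^ (d - i)) (d * m) = coeff r m ^ i * coeff s m ^ (d - i)"
      unfolding dm using coeff_power_bound assms coeff_mult_bound by metis
    show "degree (r ^ i * s ^ (d - i)) \<le> d * m"
      unfolding dm using coeff_power_bound assms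
      by (meson add_mono degree_mult_le order_trans)
  qed
  show "degree (hom_subst d p r s) \<le> d * m"
    unfolding hom_subst_def using * by (intro degree_sum_le) (auto intro: order_trans[OF degree_smult_le])
  show "coeff (hom_subst d p r s) (d * m) = hom_eval d p (coeff r m) (coeff s m)"
    unfolding hom_subst_def hom_eval_def coeff_sum using * by (intro sum.cong) auto
qed

text \<open>Substituting forms into forms multiplies degrees, and the composed forms have no common zero
  because neither pair has one; no cancellation can occur. This is where degrees become multiplicative.\<close>

lemma morphism_comp:
  assumes "morphism d U" "morphism m V"
  shows "morphism (d * m) (U \<circ> V)"
proof -
  obtain p q where U: "no_common_zero d p q" "U = hom_map d p q"
    using assms(1) by (auto simp: morphism_def)
  obtain r s where V: "no_common_zero m r s" "V = hom_map m r s"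
    using assms(2) by (auto simp: morphism_def)
  let ?P = "hom_subst d p r s" and ?Q = "hom_subst d q r s"
  have deg: "degree p \<le> d" "degree q \<le> d" "degree r \<le> m" "degree s \<le> m"
    using U V by (auto simp: no_common_zero_def)
  have "no_common_zero (d * m) ?P ?Q"
    using hom_eval_nonzero[OF U(1)] V(1) coeff_hom_subst[OF deg(3,4)]
    by (auto simp: no_common_zero_def poly_hom_subst)
  moreover have "U \<circ> V = hom_map (d * m) ?P ?Q"
  proof
    show "(U \<circ> V) x = hom_map (d * m) ?P ?Q x" for x
      using U V deg coeff_hom_subst(2)[OF deg(3,4)]
      by (cases x) (auto simp: poly_hom_subst hom_map_cp1_of no_common_zero_def)
  qed
  ultimately show ?thesis unfolding morphism_def by blast
qed

text \<open>Over an algebraically closed field a common factor of positive degree has a root.\<close>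

lemma no_common_zero_coprime:
  assumes "no_common_zero d p q"
  shows "coprime p q"
proof (rule coprimeI)
  fix c assume c: "c dvd p" "c dvd q"
  have "poly c z \<noteq> 0" for z
    using c assms by (auto simp: no_common_zero_def elim!: dvdE)
  hence "degree c = 0"
    using fundamental_theorem_of_algebra[of c] constant_degree[of c] by blast
  moreover have "c \<noteq> 0" using c assms by (auto simp: no_common_zero_def)
  ultimately show "is_unit c" by (simp add: is_unit_iff_degree)
qed

lemma coprime_no_common_zero:
  assumes "coprime p q" "p \<noteq> 0 \<or> q \<noteq> 0"
  shows "no_common_zero (max (degree p) (degree q)) p q"
proof -
  let ?d = "max (degree p) (degree q)"
  have "coeff p ?d \<noteq> 0 \<or> coeff q ?d \<noteq> 0"
    using assms(2) by (cases "p = 0"; cases "q = 0") (auto simp: max_def)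
  thus ?thesis using coprime_poly_0[OF assms(1)] by (auto simp: no_common_zero_def)
qed

lemma rational_function_iff_morphism:
  "rational_function R \<longleftrightarrow> (\<exists>d. morphism d R) \<and> R \<noteq> (\<lambda>_. Infty)"
proof
  assume "rational_function R"
  then obtain p q where pq: "q \<noteq> 0" "coprime p q" "R = rat_map p q"
    by (auto simp: rational_function_def)
  let ?d = "max (degree p) (degree q)"
  have "no_common_zero ?d p q" using pq by (intro coprime_no_common_zero) auto
  moreover have "R = hom_map ?d p q"
  proof
    show "R x = hom_map ?d p q x" for x
      using pq(3) by (cases x) (auto simp: Let_def)
  qed
  ultimately have "morphism ?d R" unfolding morphism_def by blast
  moreover obtain z where "poly q z \<noteq> 0"
    using pq(1) poly_all_0_iff_0 by blast
  hence "R (Fin z) \<noteq> Infty" using pq(3) by (simp add: cp1_of_def)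
  ultimately show "(\<exists>d. morphism d R) \<and> R \<noteq> (\<lambda>_. Infty)"
    by auto
next
  assume "(\<exists>d. morphism d R) \<and> R \<noteq> (\<lambda>_. Infty)"
  then obtain d p q where pq: "no_common_zero d p q" "R = hom_map d p q" and R: "R \<noteq> (\<lambda>_. Infty)"
    by (auto simp: morphism_def)
  have "q \<noteq> 0"
  proof
    assume "q = 0"
    hence "R x = Infty" for x using pq by (cases x) (auto simp: cp1_of_def)
    thus False using R by auto
  qed
  moreover have "coprime p q" using pq(1) by (rule no_common_zero_coprime)
  moreover have "max (degree p) (degree q) = d"
    using pq(1) by (auto simp: no_common_zero_def max_def dest: le_degree)
  hence "R x = rat_map p q x" for x
    using pq by (cases x) (auto simp: Let_def)
  hence "R = rat_map p q" by (rule ext)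
  ultimately show "rational_function R"
    unfolding rational_function_def by blast
qed

lemma rational_functionI: "morphism d R \<Longrightarrow> R x \<noteq> Infty \<Longrightarrow> rational_function R"
  by (auto simp: rational_function_iff_morphism)

section \<open>Generic fibres and the identity theorem\<close>

text \<open>For \<open>X = curve a b\<close> this is \<open>has_degree a b\<close>, for \<open>X = UNIV\<close> the topological degree of a
  self-map of the line; one notion for both lets degrees be compared across the x-coordinate.\<close>

definition generic_fibre :: "'a set \<Rightarrow> ('a \<Rightarrow> cp1) \<Rightarrow> nat \<Rightarrow> bool" where
  "generic_fibre X f n \<longleftrightarrow>
     finite {w. \<not> (finite {x \<in> X. f x = w} \<and> card {x \<in> X. f x = w} = n)}"

lemma infinite_cp1: "infinite (UNIV :: cp1 set)"
proof
  assume "finite (UNIV :: cp1 set)"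
  hence "finite (range Fin)" by (rule finite_subset[rotated]) auto
  hence "finite (UNIV :: complex set)"
    by (rule finite_imageD) (auto simp: inj_on_def)
  thus False using infinite_UNIV_char_0 by blast
qed

lemma generic_fibre_unique:
  assumes "generic_fibre X f n" "generic_fibre X f m"
  shows "n = m"
proof -
  have "finite ({w. \<not> (finite {x \<in> X. f x = w} \<and> card {x \<in> X. f x = w} = n)}
     \<union> {w. \<not> (finite {x \<in> X. f x = w} \<and> card {x \<in> X. f x = w} = m)})" (is "finite ?B")
    using assms by (auto simp: generic_fibre_def)
  then obtain w where "w \<notin> ?B" using infinite_cp1 ex_new_if_finite by blast
  thus ?thesis by auto
qed

text \<open>The fibre over a finite value \<open>c\<close> other than \<open>R Infty\<close> consists of the roots of \<open>p - c q\<close>, a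
  polynomial of degree \<open>d\<close>. A multiple root is a zero of
  the Wronskian \<open>p q' - p' q\<close>, so only finitely many \<open>c\<close> have one, unless the Wronskian vanishes
  identically; in that case \<open>p\<close> and \<open>q\<close>, being coprime, divide their own derivatives and are constant.\<close>

lemma generic_fibre_morphism:
  assumes "morphism d R"
  shows "generic_fibre UNIV R d"
proof -
  obtain p q where pq: "no_common_zero d p q" "R = hom_map d p q"
    using assms by (auto simp: morphism_def)
  let ?W = "p * pderiv q - pderiv p * q"
  show ?thesis
  proof (cases "?W = 0")
    case True
    have "coprime p q" using pq(1) by (rule no_common_zero_coprime)
    have const: "degree r = 0" if "coprime r s" "r dvd s * pderiv r" for r s :: "complex poly"
    proof (rule ccontr)
      assume "degree r \<noteq> 0"
      moreover have "r dvd pderiv r" using that(2) coprime_dvd_mult_right_iff[OF that(1)] by simp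
      ultimately show False using not_dvd_pderiv[of r] by simp
    qed
    have W: "p * pderiv q = q * pderiv p" using True by (simp add: mult.commute)
    have "degree p = 0" using const[of p q] \<open>coprime p q\<close> dvd_triv_left[of p "pderiv q"] W by simp
    moreover have "degree q = 0"
      using const[of q p] \<open>coprime p q\<close> dvd_triv_left[of q "pderiv p"] W
      by (simp add: coprime_commute)
    ultimately have [simp]: "d = 0"
      using pq(1) coeff_eq_0[of p d] coeff_eq_0[of q d] by (cases d) (auto simp: no_common_zero_def)
    obtain a where a: "p = [:a:]" using \<open>degree p = 0\<close> degree_eq_zeroE by blast
    obtain b where b: "q = [:b:]" using \<open>degree q = 0\<close> degree_eq_zeroE by blast
    note ab = a b
    have "R x = cp1_of a b" for x
      using pq ab by (cases x) auto
    hence "{w. \<not> (finite {x \<in> UNIV. R x = w} \<and> card {x \<in> UNIV. R x = w} = d)} \<subseteq> {cp1_of a b}"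
      by auto
    thus ?thesis unfolding generic_fibre_def using finite_subset by blast
  next
    case False
    let ?B = "{Infty, R Infty} \<union> (\<lambda>z. R (Fin z)) ` {z. poly ?W z = 0}"
    have "finite ?B" using poly_roots_finite[OF False] by simp
    have "finite {x. R x = w} \<and> card {x. R x = w} = d" if w: "w \<notin> ?B" for w
    proof -
      obtain c where c: "w = Fin c" using w by (cases w) auto
      let ?g = "p - smult c q"
      have ncz: "degree p \<le> d" "degree q \<le> d" "\<And>z. poly p z = 0 \<Longrightarrow> poly q z = 0 \<Longrightarrow> False"
        "coeff p d \<noteq> 0 \<or> coeff q d \<noteq> 0"
        using pq(1) by (auto simp: no_common_zero_def)
      have lc: "coeff ?g d \<noteq> 0"
      proof
        assume "coeff ?g d = 0"
        hence "R Infty = cp1_of c 1" using ncz(4) pq(2) by (simp add: cp1_of_eq_iff)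
        thus False using w c by (simp add: cp1_of_def)
      qed
      have "degree (smult c q) \<le> d" using ncz(2) degree_smult_le[of c q] by linarith
      hence "degree ?g \<le> d" using degree_diff_le[OF ncz(1)] by blast
      hence deg: "degree ?g = d" using le_degree[OF lc] by (rule le_antisym)
      have g0: "?g \<noteq> 0" using lc by auto
      have fib: "{x. R x = w} = Fin ` {z. poly ?g z = 0}"
      proof (rule set_eqI)
        fix x show "x \<in> {x. R x = w} \<longleftrightarrow> x \<in> Fin ` {z. poly ?g z = 0}"
        proof (cases x)
          case Infty
          thus ?thesis using w by auto
        next
          case (Fin z)
          have "R x = w \<longleftrightarrow> poly ?g z = 0"
            using Fin pq(2) c ncz(3)[of z] cp1_of_eq_iff[of "poly p z" "poly q z" c 1]
            by (auto simp: cp1_of_def[of c 1])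
          thus ?thesis using Fin by auto
        qed
      qed
      have "rsquarefree ?g"
      proof (unfold rsquarefree_roots, intro allI notI)
        fix z assume z: "poly ?g z = 0 \<and> poly (pderiv ?g) z = 0"
        hence "poly p z = c * poly q z" "poly (pderiv p) z = c * poly (pderiv q) z"
          by (simp_all add: pderiv_diff pderiv_smult)
        hence "poly ?W z = 0" by simp
        moreover have "R (Fin z) = w"
          using fib z by blast
        ultimately show False using w by blast
      qed
      hence "smult (lead_coeff ?g) (\<Prod>z | poly ?g z = 0. [:-z, 1:]) = ?g"
        by (rule complex_poly_decompose_rsquarefree)
      hence "degree ?g = degree (smult (lead_coeff ?g) (\<Prod>z | poly ?g z = 0. [:-z, 1:]))"
        by (rule arg_cong[OF sym])
      also have "\<dots> = degree (\<Prod>z | poly ?g z = 0. [:-z, 1::complex:])"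
        using g0 by (simp del: coeff_diff)
      also have "\<dots> = card {z. poly ?g z = 0}"
        by (subst degree_prod_eq_sum_degree) auto
      finally have "card {z. poly ?g z = 0} = d" using deg by simp
      moreover have "card (Fin ` {z. poly ?g z = 0}) = card {z. poly ?g z = 0}"
        by (rule card_image) (auto simp: inj_on_def)
      ultimately show ?thesis using fib poly_roots_finite[OF g0] by simp
    qed
    hence "{w. \<not> (finite {x \<in> UNIV. R x = w} \<and> card {x \<in> UNIV. R x = w} = d)} \<subseteq> ?B"
      by auto
    thus ?thesis unfolding generic_fibre_def using \<open>finite ?B\<close> by (rule finite_subset)
  qed
qed

lemma morphism_degree_unique: "morphism d R \<Longrightarrow> morphism d' R \<Longrightarrow> d = d'"
  using generic_fibre_morphism generic_fibre_unique by blast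

lemma poly_eq_0_cofinite:
  fixes p :: "complex poly"
  assumes "finite B" "\<And>z. z \<notin> B \<Longrightarrow> poly p z = 0"
  shows "p = 0"
proof (rule ccontr)
  assume "p \<noteq> 0"
  hence "finite ({z. poly p z = 0} \<union> B)" using assms poly_roots_finite by blast
  moreover have "{z. poly p z = 0} \<union> B = UNIV" using assms by blast
  ultimately show False using infinite_UNIV_char_0[where 'a=complex] by simp
qed

lemma morphism_identity:
  assumes "morphism d R" "morphism e S" "finite B" "\<And>z. z \<notin> B \<Longrightarrow> R (Fin z) = S (Fin z)"
  shows "R = S"
proof -
  obtain p q where R: "no_common_zero d p q" "R = hom_map d p q"
    using assms(1) by (auto simp: morphism_def)
  obtain r s where S: "no_common_zero e r s" "S = hom_map e r s"
    using assms(2) by (auto simp: morphism_def)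
  have "p * s - r * q = 0"
  proof (rule poly_eq_0_cofinite[OF assms(3)])
    fix z assume "z \<notin> B"
    thus "poly (p * s - r * q) z = 0" using assms(4)[of z] R S
      by (simp add: no_common_zero_def cp1_of_eq_iff)
  qed
  hence eq: "p * s = r * q" by simp
  have "coeff p d * coeff s e = coeff r e * coeff q d"
    using eq coeff_mult_bound[of p d s e] coeff_mult_bound[of r e q d] R S
    by (simp add: no_common_zero_def add.commute)
  moreover have "poly p z * poly s z = poly r z * poly q z" for z
    using eq by (metis poly_mult)
  ultimately have "R x = S x" for x
    using R S by (cases x) (simp_all add: no_common_zero_def cp1_of_eq_iff)
  thus ?thesis by auto
qed

section \<open>Moebius transformations\<close>

lemma morphism_surj:
  assumes "morphism d R" "d > 0"
  shows "surj R"
proof -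
  obtain p q where pq: "no_common_zero d p q" "R = hom_map d p q"
    using assms by (auto simp: morphism_def)
  have "\<exists>x. R x = w" for w
  proof -
    obtain u v where uv: "w = cp1_of u v" "u \<noteq> 0 \<or> v \<noteq> 0"
    proof (cases w)
      case (Fin c)
      thus ?thesis using that[of c 1] by (simp add: cp1_of_def)
    next
      case Infty
      thus ?thesis using that[of 1 0] by (simp add: cp1_of_def)
    qed
    let ?g = "smult v p - smult u q"
    have ncz: "degree p \<le> d" "degree q \<le> d" "\<And>z. poly p z \<noteq> 0 \<or> poly q z \<noteq> 0"
        "coeff p d \<noteq> 0 \<or> coeff q d \<noteq> 0"
        using pq(1) by (auto simp: no_common_zero_def)
    show ?thesis
    proof (cases "coeff ?g d = 0")
      case True
      hence "R Infty = w" using pq(2) uv ncz(4) by (simp add: cp1_of_eq_iff mult.commute)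
      thus ?thesis by blast
    next
      case False
      hence "degree ?g > 0" using assms(2) le_degree by fastforce
      then obtain z where "poly ?g z = 0"
        using fundamental_theorem_of_algebra[of ?g] constant_degree[of ?g] by auto
      hence "R (Fin z) = w" using pq(2) uv ncz(3)[of z] by (simp add: cp1_of_eq_iff mult.commute)
      thus ?thesis by blast
    qed
  qed
  thus ?thesis unfolding surj_def by metis
qed

definition moebius :: "complex \<Rightarrow> complex \<Rightarrow> complex \<Rightarrow> complex \<Rightarrow> cp1 \<Rightarrow> cp1" where
  "moebius \<alpha> \<beta> \<gamma> \<delta> = hom_map 1 [:\<beta>, \<alpha>:] [:\<delta>, \<gamma>:]"

lemma moebius_simps [simp]:
  "moebius \<alpha> \<beta> \<gamma> \<delta> (Fin z) = cp1_of (\<alpha> * z + \<beta>) (\<gamma> * z + \<delta>)"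
  "moebius \<alpha> \<beta> \<gamma> \<delta> Infty = cp1_of \<alpha> \<gamma>"
  by (simp_all add: moebius_def algebra_simps)

lemma morphism_moebius: "\<alpha> * \<delta> - \<beta> * \<gamma> \<noteq> 0 \<Longrightarrow> morphism 1 (moebius \<alpha> \<beta> \<gamma> \<delta>)"
  unfolding morphism_def moebius_def
proof (intro exI conjI)
  assume det: "\<alpha> * \<delta> - \<beta> * \<gamma> \<noteq> 0"
  have "\<beta> + z * \<alpha> \<noteq> 0 \<or> \<delta> + z * \<gamma> \<noteq> 0" for z
  proof (rule ccontr)
    assume "\<not> ?thesis"
    hence "\<beta> = - (z * \<alpha>)" "\<delta> = - (z * \<gamma>)" by (auto simp: eq_neg_iff_add_eq_0)
    thus False using det by simp
  qed
  thus "no_common_zero 1 [:\<beta>, \<alpha>:] [:\<delta>, \<gamma>:]" using det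
    by (auto simp: no_common_zero_def degree_pCons_le)
qed (rule refl)

lemma morphism_1_moebius:
  assumes "morphism 1 M"
  obtains \<alpha> \<beta> \<gamma> \<delta> where "\<alpha> * \<delta> - \<beta> * \<gamma> \<noteq> 0" "M = moebius \<alpha> \<beta> \<gamma> \<delta>"
proof -
  obtain p q where pq: "no_common_zero 1 p q" "M = hom_map 1 p q"
    using assms by (auto simp: morphism_def)
  have *: "r = [:coeff r 0, coeff r 1:]" if "degree r \<le> 1" for r :: "complex poly"
    using that by (auto simp: poly_eq_iff coeff_pCons coeff_eq_0 split: nat.split)
  define \<alpha> \<beta> \<gamma> \<delta> where d: "\<alpha> = coeff p 1" "\<beta> = coeff p 0" "\<gamma> = coeff q 1" "\<delta> = coeff q 0"
  have p: "p = [:\<beta>, \<alpha>:]" and q: "q = [:\<delta>, \<gamma>:]"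
    unfolding d using pq(1) by (intro *; simp add: no_common_zero_def)+
  have z: "\<beta> + z * \<alpha> \<noteq> 0 \<or> \<delta> + z * \<gamma> \<noteq> 0" "\<alpha> \<noteq> 0 \<or> \<gamma> \<noteq> 0" for z
    using pq(1) unfolding no_common_zero_def p q by auto
  have "\<alpha> * \<delta> - \<beta> * \<gamma> \<noteq> 0"
  proof
    assume det: "\<alpha> * \<delta> - \<beta> * \<gamma> = 0"
    show False
    proof (cases "\<alpha> = 0")
      case True
      thus False using det z(1)[of "- \<delta> / \<gamma>"] z(2) by simp
    next
      case False
      hence "\<delta> = \<beta> / \<alpha> * \<gamma>" using det by (simp add: field_simps)
      thus False using False z(1)[of "- \<beta> / \<alpha>"] by simp
    qed
  qed
  thus ?thesis using that pq(2) p q by (auto simp: moebius_def)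
qed

lemma moebius_cp1_of:
  assumes "u \<noteq> 0 \<or> v \<noteq> 0"
  shows "moebius \<alpha> \<beta> \<gamma> \<delta> (cp1_of u v) = cp1_of (\<alpha> * u + \<beta> * v) (\<gamma> * u + \<delta> * v)"
proof -
  have "hom_eval 1 [:b, a:] u v = a * u + b * v" for a b
    by (simp add: hom_eval_def)
  thus ?thesis
    using hom_map_cp1_of[of "[:\<beta>, \<alpha>:]" 1 "[:\<delta>, \<gamma>:]" u v] assms
    by (simp add: moebius_def degree_pCons_le)
qed

text \<open>The adjugate matrix inverts up to the determinant, a scalar that homogeneous coordinates ignore.\<close>

lemma moebius_inverse:
  assumes "\<alpha> * \<delta> - \<beta> * \<gamma> \<noteq> 0"
  shows "moebius \<delta> (-\<beta>) (-\<gamma>) \<alpha> (moebius \<alpha> \<beta> \<gamma> \<delta> x) = x"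
proof -
  have *: "moebius \<delta> (-\<beta>) (-\<gamma>) \<alpha> (moebius \<alpha> \<beta> \<gamma> \<delta> (cp1_of u v)) = cp1_of u v"
    if uv: "u \<noteq> 0 \<or> v \<noteq> 0" for u v
  proof -
    define k u' v' where k: "k = \<alpha> * \<delta> - \<beta> * \<gamma>"
      and u': "u' = \<alpha> * u + \<beta> * v" and v': "v' = \<gamma> * u + \<delta> * v"
    have *: "\<delta> * u' + (-\<beta>) * v' = k * u" "(-\<gamma>) * u' + \<alpha> * v' = k * v"
      unfolding k u' v' by algebra+
    have "k \<noteq> 0" using assms k by simp
    hence "u' \<noteq> 0 \<or> v' \<noteq> 0" using * uv by force
    thus ?thesis
      using moebius_cp1_of[OF uv, of \<alpha> \<beta> \<gamma> \<delta>] moebius_cp1_of[of u' v' \<delta> "-\<beta>" "-\<gamma>" \<alpha>]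
        cp1_of_scale[OF \<open>k \<noteq> 0\<close>, of u v]
      unfolding * u'[symmetric] v'[symmetric] by simp
  qed
  show ?thesis
    using *[of 1 0] *[of _ 1] by (cases x) (auto simp: cp1_of_def simp del: moebius_simps)
qed

lemma morphism_1_inv:
  assumes "morphism 1 M"
  shows "bij M" "morphism 1 (inv M)"
proof -
  obtain \<alpha> \<beta> \<gamma> \<delta> where M: "\<alpha> * \<delta> - \<beta> * \<gamma> \<noteq> 0" "M = moebius \<alpha> \<beta> \<gamma> \<delta>"
    using assms by (rule morphism_1_moebius)
  let ?N = "moebius \<delta> (-\<beta>) (-\<gamma>) \<alpha>"
  have 1: "?N (M x) = x" for x unfolding M(2) by (rule moebius_inverse[OF M(1)])
  have inj: "inj M" using 1 by (rule inj_on_inverseI)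
  have surj: "surj M" using morphism_surj[OF assms] by simp
  show "bij M" using inj surj by (rule bijI)
  have "inv M = ?N"
  proof (rule inv_equality)
    fix y
    obtain x where "y = M x" using surj by (rule surjE)
    thus "M (?N y) = y" using 1 by simp
  qed (rule 1)
  moreover have "\<delta> * \<alpha> - (-\<beta>) * (-\<gamma>) \<noteq> 0" using M(1) by (simp add: mult.commute)
  ultimately show "morphism 1 (inv M)" using morphism_moebius by simp
qed

lemma morphism_id: "morphism 1 id"
proof -
  have "id x = moebius 1 0 0 1 x" for x by (cases x) (auto simp: cp1_of_def)
  hence "id = moebius 1 0 0 1" by (rule ext)
  thus ?thesis using morphism_moebius[of 1 1 0 0] by simp
qed

lemma morphism_imp_rational_function: "morphism d R \<Longrightarrow> d > 0 \<Longrightarrow> rational_function R"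
proof -
  assume R: "morphism d R" "d > 0"
  obtain x where "Fin 0 = R x" using morphism_surj[OF R] by (rule surjE)
  thus ?thesis using rational_functionI[OF R(1), of x] by (metis cp1.distinct(1))
qed

section \<open>The modular curve of level 2\<close>

text \<open>The curve \<open>Phi2 = 0\<close> has genus zero; \<open>h\<close> is a coordinate on it (a Hauptmodul of level 2). The two
  fractions are the invariants of a curve and of its 2-isogenous curve in this coordinate, see
  \<open>isogenous_j_invariants\<close>.\<close>

lemma modular_parametrization:
  assumes "h \<noteq> 0"
  shows "Phi2 (256 * (h - 1) ^ 3 / h) (16 * (16 - h) ^ 3 / h ^ 2) = 0"
proof -
  define x y where x: "x = 256 * (h - 1) ^ 3 / h" and y: "y = 16 * (16 - h) ^ 3 / h ^ 2"
  have "x * h = 256 * (h - 1) ^ 3" "y * h ^ 2 = 16 * (16 - h) ^ 3"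
    using assms by (simp_all add: x y)
  \<comment> \<open>Multiplication by \<open>h\<^sup>6\<close> clears the denominators \<open>h\<close> and \<open>h\<^sup>2\<close> in every monomial of \<open>Phi2\<close>.\<close>
  hence "h ^ 6 * Phi2 x y = - ((256 * (h - 1) ^ 3) ^ 2 * (16 * (16 - h) ^ 3) ^ 2)
     + h ^ 3 * (256 * (h - 1) ^ 3) ^ 3 + (16 * (16 - h) ^ 3) ^ 3
     + 2 ^ 4 * 3 * 31 * h * (256 * (h - 1) ^ 3) * (16 * (16 - h) ^ 3) * (h * (256 * (h - 1) ^ 3) + 16 * (16 - h) ^ 3)
     + 3 ^ 4 * 5 ^ 3 * 4027 * (256 * (h - 1) ^ 3) * (16 * (16 - h) ^ 3) * h ^ 3
     - 2 ^ 4 * 3 ^ 4 * 5 ^ 3 * h ^ 2 * (h ^ 2 * (256 * (h - 1) ^ 3) ^ 2 + (16 * (16 - h) ^ 3) ^ 2)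
     + 2 ^ 8 * 3 ^ 7 * 5 ^ 6 * h ^ 4 * (h * (256 * (h - 1) ^ 3) + 16 * (16 - h) ^ 3)
     - 2 ^ 12 * 3 ^ 9 * 5 ^ 9 * h ^ 6"
    unfolding Phi2_def by algebra
  also have "\<dots> = 0" by algebra
  finally show ?thesis using assms x y by simp
qed

lemma cubic_roots:
  fixes p q r :: complex
  obtains u1 u2 u3 where "u1 + u2 + u3 = - p" "u1 * u2 + u1 * u3 + u2 * u3 = q" "u1 * u2 * u3 = - r"
proof -
  have "degree [:r, q, p, 1:] = 3" by simp
  then obtain u1 where "poly [:r, q, p, 1:] u1 = 0"
    using fundamental_theorem_of_algebra[of "[:r, q, p, 1:]"] constant_degree[of "[:r, q, p, 1:]"]
    by auto
  hence u1: "u1 ^ 3 + p * u1 ^ 2 + q * u1 + r = 0"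
    by (simp add: algebra_simps power3_eq_cube power2_eq_square)
  define b c where b: "b = u1 + p" and c: "c = q + u1 * (u1 + p)"
  define u2 where "u2 = (- b + csqrt (b\<^sup>2 - 4 * c)) / 2"
  have "2 * u2 + b = csqrt (b\<^sup>2 - 4 * c)" by (simp add: u2_def)
  hence "(2 * u2 + b)\<^sup>2 = b\<^sup>2 - 4 * c" by simp
  hence u2: "u2\<^sup>2 + b * u2 + c = 0" by algebra
  show ?thesis
  proof (rule that[of u1 u2 "- b - u2"])
    show "u1 + u2 + (- b - u2) = - p" by (simp add: b)
    show "u1 * u2 + u1 * (- b - u2) + u2 * (- b - u2) = q" using u2 unfolding b c by algebra
    show "u1 * u2 * (- b - u2) = - r" using u1 u2 unfolding b c by algebra
  qed
qed

text \<open>For fixed \<open>x = 256 k\<close> the parameters \<open>h = 1/u\<close> over \<open>x\<close> are given by the three roots \<open>u\<close> of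
  \<open>u\<^sup>3 - (3 - k) u\<^sup>2 + 3 u - 1\<close>, whose elementary symmetric functions are the hypotheses. Modulo this cubic
  the second coordinate \<open>16 (16 - h)\<^sup>3 / h\<^sup>2\<close> is the quadratic polynomial \<open>w u\<close>. So \<open>Phi2 x\<close>, a monic cubic
  in the second variable, splits into the factors \<open>y - w u\<close>: the parametrization hits every point.\<close>

lemma Phi2_as_norm:
  fixes u1 u2 u3 k y :: complex
  assumes "u1 + u2 + u3 = 3 - k" "u1 * u2 + u1 * u3 + u2 * u3 = 3" "u1 * u2 * u3 = 1"
  defines "w \<equiv> \<lambda>u. 16 * (4095 * u ^ 2 - (765 + k) * u + 45)"
  shows "Phi2 (256 * k) y = (y - w u1) * (y - w u2) * (y - w u3)"
proof -
  define A B C where d: "A = (16 * 4095 :: complex)" "B = - 16 * (765 + k)" "C = (16 * 45 :: complex)"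
  define e1 e2 e3 where e: "e1 = u1 + u2 + u3" "e2 = u1 * u2 + u1 * u3 + u2 * u3" "e3 = u1 * u2 * u3"
  have w: "w u = A * u ^ 2 + B * u + C" for u
    unfolding w_def d by algebra
  \<comment> \<open>The elementary symmetric functions of the three values of \<open>w\<close> in terms of those of the roots.\<close>
  have 1: "w u1 + w u2 + w u3 = A * (e1 ^ 2 - 2 * e2) + B * e1 + 3 * C"
    unfolding w e by algebra
  have 2: "w u1 * w u2 + w u1 * w u3 + w u2 * w u3 =
      A ^ 2 * (e2 ^ 2 - 2 * e1 * e3) + A * B * (e1 * e2 - 3 * e3) + B ^ 2 * e2
      + 2 * A * C * (e1 ^ 2 - 2 * e2) + 2 * B * C * e1 + 3 * C ^ 2"
    unfolding w e by algebra
  have 3: "w u1 * w u2 * w u3 =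
      A ^ 3 * e3 ^ 2 + A ^ 2 * B * e3 * e2 + A ^ 2 * C * (e2 ^ 2 - 2 * e1 * e3) + A * B ^ 2 * e3 * e1
      + A * B * C * (e1 * e2 - 3 * e3) + A * C ^ 2 * (e1 ^ 2 - 2 * e2) + B ^ 3 * e3
      + B ^ 2 * C * e2 + B * C ^ 2 * e1 + C ^ 3"
    unfolding w e by algebra
  have "(y - w u1) * (y - w u2) * (y - w u3) = y ^ 3 - (w u1 + w u2 + w u3) * y ^ 2
      + (w u1 * w u2 + w u1 * w u3 + w u2 * w u3) * y - w u1 * w u2 * w u3"
    by algebra
  also have "\<dots> = Phi2 (256 * k) y"
    unfolding 1 2 3 unfolding e assms(1-3) d Phi2_def power_one mult_1_right by algebra
  finally show ?thesis by simp
qed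

lemma Phi2_eq_0_iff:
  "Phi2 x y = 0 \<longleftrightarrow> (\<exists>h. h \<noteq> 0 \<and> x = 256 * (h - 1) ^ 3 / h \<and> y = 16 * (16 - h) ^ 3 / h ^ 2)"
proof
  assume *: "Phi2 x y = 0"
  define k where "k = x / 256"
  \<comment> \<open>The \<open>u\<close> are the reciprocals of the parameters \<open>h\<close> over \<open>x\<close>.\<close>
  obtain u1 u2 u3 where u: "u1 + u2 + u3 = 3 - k" "u1 * u2 + u1 * u3 + u2 * u3 = 3" "u1 * u2 * u3 = 1"
    using cubic_roots[of "k - 3" 3 "-1"] by (metis minus_diff_eq minus_minus)
  have "(y - 16 * (4095 * u1 ^ 2 - (765 + k) * u1 + 45)) * (y - 16 * (4095 * u2 ^ 2 - (765 + k) * u2 + 45))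
      * (y - 16 * (4095 * u3 ^ 2 - (765 + k) * u3 + 45)) = 0"
    using Phi2_as_norm[OF u, of y] * by (simp add: k_def)
  then obtain u where uy: "u \<in> {u1, u2, u3}" "y = 16 * (4095 * u ^ 2 - (765 + k) * u + 45)"
    by auto
  have "u \<noteq> 0" using uy(1) u(3) by auto
  have "u ^ 3 - (u1 + u2 + u3) * u ^ 2 + (u1 * u2 + u1 * u3 + u2 * u3) * u - u1 * u2 * u3 = 0"
    using uy(1) by (auto simp: algebra_simps power2_eq_square power3_eq_cube)
  hence ku: "k * u ^ 2 = (1 - u) ^ 3" unfolding u by algebra
  have yu: "y * u = 16 * (16 * u - 1) ^ 3" unfolding uy(2) using ku by algebra
  have "x = 256 * (1 / u - 1) ^ 3 / (1 / u)"
  proof -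
    have "256 * (1 / u - 1) ^ 3 / (1 / u) = 256 * (1 - u) ^ 3 / u ^ 2"
      using \<open>u \<noteq> 0\<close> by (simp add: divide_simps power3_eq_cube power2_eq_square)
    also have "\<dots> = x" using \<open>u \<noteq> 0\<close> ku[symmetric] by (simp add: k_def field_simps)
    finally show ?thesis by simp
  qed
  moreover have "y = 16 * (16 - 1 / u) ^ 3 / (1 / u) ^ 2"
  proof -
    have "16 * (16 - 1 / u) ^ 3 / (1 / u) ^ 2 = 16 * (16 * u - 1) ^ 3 / u"
      using \<open>u \<noteq> 0\<close> by (simp add: divide_simps power3_eq_cube power2_eq_square)
    also have "\<dots> = y" using \<open>u \<noteq> 0\<close> yu[symmetric] by simp
    finally show ?thesis by simp
  qed
  ultimately show "\<exists>h. h \<noteq> 0 \<and> x = 256 * (h - 1) ^ 3 / h \<and> y = 16 * (16 - h) ^ 3 / h ^ 2"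
    using \<open>u \<noteq> 0\<close> by (intro exI[of _ "1 / u"]) simp
qed (auto simp: modular_parametrization)

lemma Phi2_sym: "Phi2 x y = Phi2 y x"
  unfolding Phi2_def by algebra

text \<open>\<open>256 (h - 1)\<^sup>3 = x h\<close> is a cubic equation for \<open>h\<close> and \<open>0\<close> is not a solution of it.\<close>

lemma Phi2_ex: "\<exists>y. Phi2 x y = 0"
proof -
  have "degree [:- 256, 768 - x, - 768, 256:] = 3" by simp
  then obtain h where h: "poly [:- 256, 768 - x, - 768, 256:] h = 0"
    using fundamental_theorem_of_algebra[of "[:- 256, 768 - x, - 768, 256:]"]
      constant_degree[of "[:- 256, 768 - x, - 768, 256:]"] by auto
  moreover have "poly [:- 256, 768 - x, - 768, 256:] h = 256 * (h - 1) ^ 3 - x * h"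
    by (simp add: algebra_simps power3_eq_cube)
  ultimately have h: "x * h = 256 * (h - 1) ^ 3" by simp
  hence "h \<noteq> 0" by auto
  hence "x = 256 * (h - 1) ^ 3 / h" using h by (simp add: field_simps)
  thus ?thesis using modular_parametrization[OF \<open>h \<noteq> 0\<close>] by blast
qed

section \<open>The doubling map and its factorization through a 2-isogeny\<close>

text \<open>The x-coordinate of \<open>2 P\<close> as a function of the x-coordinate of \<open>P\<close>.\<close>

definition doubling :: "complex \<Rightarrow> complex \<Rightarrow> cp1 \<Rightarrow> cp1" where
  "doubling a b = hom_map 4 [:a ^ 2, - 8 * b, - 2 * a, 0, 1:] [:4 * b, 4 * a, 0, 4:]"

text \<open>Velu's formula \<open>x + t / (x - e)\<close> for the quotient by a 2-torsion point with x-coordinate \<open>e\<close>, where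
  \<open>t = 3 e\<^sup>2 + a\<close>.\<close>

definition isogeny_x :: "complex \<Rightarrow> complex \<Rightarrow> cp1 \<Rightarrow> cp1" where
  "isogeny_x e t = hom_map 2 [:t, - e, 1:] [:- e, 1:]"

text \<open>The same formula \<open>x + s / (x + 2 e)\<close> on the isogenous curve, where \<open>-2 e\<close> is the root whose
  2-torsion point generates the kernel of the dual isogeny and \<open>s = - 3 e\<^sup>2 - 4 a\<close>. The factor
  \<open>1/4\<close> undoes the scaling between the curve and the quotient by its whole 2-torsion.\<close>

definition dual_isogeny_x :: "complex \<Rightarrow> complex \<Rightarrow> cp1 \<Rightarrow> cp1" where
  "dual_isogeny_x e s = hom_map 2 [:s, 2 * e, 1:] [:8 * e, 4:]"

lemma doubling_Infty [simp]: "doubling a b Infty = Infty"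
  by (simp add: doubling_def cp1_of_def eval_nat_numeral)

lemma doubling_Fin:
  "doubling a b (Fin x) = cp1_of (x ^ 4 - 2 * a * x ^ 2 - 8 * b * x + a ^ 2) (4 * (x ^ 3 + a * x + b))"
  unfolding doubling_def hom_map.simps by (intro arg_cong2[of _ _ _ _ cp1_of]; simp; algebra)

lemma isogeny_x_simps:
  "isogeny_x e t (Fin x) = cp1_of (x ^ 2 - e * x + t) (x - e)"
  "isogeny_x e t Infty = Infty"
  unfolding isogeny_x_def hom_map.simps 
  by (intro arg_cong2[of _ _ _ _ cp1_of]; simp; algebra) (simp add: cp1_of_def eval_nat_numeral)

lemma dual_isogeny_x_simps:
  "dual_isogeny_x e s (Fin x) = cp1_of (x ^ 2 + 2 * e * x + s) (4 * (x + 2 * e))"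
  "dual_isogeny_x e s Infty = Infty"
  unfolding dual_isogeny_x_def hom_map.simps
  by (intro arg_cong2[of _ _ _ _ cp1_of]; simp; algebra) (simp add: cp1_of_def eval_nat_numeral)

lemma elliptic_no_double_root:
  assumes "elliptic_curve a b" "x ^ 3 + a * x + b = 0"
  shows "3 * x ^ 2 + a \<noteq> 0"
proof
  assume "3 * x ^ 2 + a = 0"
  hence "4 * a ^ 3 + 27 * b ^ 2 = 0" using assms(2) by algebra
  thus False using assms(1) by (simp add: elliptic_curve_def)
qed

text \<open>Modulo the cubic the numerator is the square of its derivative. Hence numerator and denominator of
  the doubling map have no common zero on a nonsingular curve.\<close>

lemma doubling_numerator_nonzero:
  assumes "elliptic_curve a b" "x ^ 3 + a * x + b = 0"
  shows "x ^ 4 - 2 * a * x ^ 2 - 8 * b * x + a ^ 2 \<noteq> 0"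
proof -
  have "x ^ 4 - 2 * a * x ^ 2 - 8 * b * x + a ^ 2 = (3 * x ^ 2 + a) ^ 2"
    using assms(2) by algebra
  thus ?thesis using elliptic_no_double_root[OF assms] by simp
qed

lemma morphism_doubling:
  assumes "elliptic_curve a b"
  shows "morphism 4 (doubling a b)"
proof -
  let ?p = "[:a ^ 2, - 8 * b, - 2 * a, 0, 1:]" and ?q = "[:4 * b, 4 * a, 0, 4:]"
  have "poly ?p x \<noteq> 0 \<or> poly ?q x \<noteq> 0" for x
  proof (rule ccontr)
    assume "\<not> ?thesis"
    hence "poly ?p x = 0" "poly ?q x = 0" by blast+
    hence "x ^ 4 - 2 * a * x ^ 2 - 8 * b * x + a ^ 2 = 0" "x ^ 3 + a * x + b = 0"
      by (simp, algebra)+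
    thus False using doubling_numerator_nonzero[OF assms] by blast
  qed
  thus ?thesis unfolding morphism_def doubling_def
    by (intro exI[of _ ?p] exI[of _ ?q]) (simp add: no_common_zero_def eval_nat_numeral)
qed

lemma morphism_isogeny_x:
  assumes "t \<noteq> 0"
  shows "morphism 2 (isogeny_x e t)"
  unfolding morphism_def isogeny_x_def
  by (intro exI[of _ "[:t, - e, 1:]"] exI[of _ "[:- e, 1:]"])
    (use assms in \<open>auto simp: no_common_zero_def eval_nat_numeral eq_neg_iff_add_eq_0 algebra_simps\<close>)

lemma morphism_dual_isogeny_x:
  assumes "s \<noteq> 0"
  shows "morphism 2 (dual_isogeny_x e s)"
proof -
  have "poly [:s, 2 * e, 1:] x \<noteq> 0 \<or> poly [:8 * e, 4:] x \<noteq> 0" for x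
  proof (rule ccontr)
    assume "\<not> ?thesis"
    hence "s + x * (2 * e + x) = 0" "8 * e + 4 * x = 0" by (simp_all add: mult.commute)
    hence "s = 0" by algebra
    thus False using assms by simp
  qed
  thus ?thesis unfolding morphism_def dual_isogeny_x_def
    by (intro exI[of _ "[:s, 2 * e, 1:]"] exI[of _ "[:8 * e, 4:]"])
      (simp add: no_common_zero_def eval_nat_numeral)
qed

lemma isogeny_x_cp1_of:
  assumes "u \<noteq> 0 \<or> v \<noteq> 0"
  shows "isogeny_x e t (cp1_of u v) = cp1_of (u ^ 2 - e * u * v + t * v ^ 2) ((u - e * v) * v)"
proof -
  have "hom_eval 2 [:t, - e, 1:] u v = u ^ 2 - e * u * v + t * v ^ 2"
    "hom_eval 2 [:- e, 1:] u v = (u - e * v) * v"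
    by (simp_all add: hom_eval_def eval_nat_numeral algebra_simps)
  thus ?thesis unfolding isogeny_x_def using assms by (simp add: hom_map_cp1_of)
qed

lemma dual_isogeny_x_cp1_of:
  assumes "u \<noteq> 0 \<or> v \<noteq> 0"
  shows "dual_isogeny_x e s (cp1_of u v) = cp1_of (u ^ 2 + 2 * e * u * v + s * v ^ 2) (4 * (u + 2 * e * v) * v)"
proof -
  have "hom_eval 2 [:s, 2 * e, 1:] u v = u ^ 2 + 2 * e * u * v + s * v ^ 2"
    "hom_eval 2 [:8 * e, 4:] u v = 4 * (u + 2 * e * v) * v"
    by (simp_all add: hom_eval_def eval_nat_numeral algebra_simps)
  thus ?thesis unfolding dual_isogeny_x_def using assms by (simp add: hom_map_cp1_of)
qed

lemma discriminant_factor: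
  fixes a b e :: complex
  assumes "e ^ 3 + a * e + b = 0"
  shows "4 * a ^ 3 + 27 * b ^ 2 = (3 * e ^ 2 + a) ^ 2 * (3 * e ^ 2 + 4 * a)"
  using assms by algebra

text \<open>Coefficients of the quotient of \<open>y\<^sup>2 = x\<^sup>3 + a x + b\<close> by the 2-torsion point \<open>(e, 0)\<close>, where
  \<open>b = - e\<^sup>3 - a e\<close>: Velu's \<open>a - 5 t\<close> and \<open>b - 7 e t\<close>.\<close>

definition isogenous_a :: "complex \<Rightarrow> complex \<Rightarrow> complex" where
  "isogenous_a a e = - 15 * e ^ 2 - 4 * a"

definition isogenous_b :: "complex \<Rightarrow> complex \<Rightarrow> complex" where
  "isogenous_b a e = - 22 * e ^ 3 - 8 * a * e"

lemma isogenous_discriminant: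
  "4 * isogenous_a a e ^ 3 + 27 * isogenous_b a e ^ 2 = - 16 * (3 * e ^ 2 + 4 * a) ^ 2 * (3 * e ^ 2 + a)"
  unfolding isogenous_a_def isogenous_b_def by algebra

text \<open>Multiplication by 2 is the isogeny followed by its dual, on either curve. On x-coordinates both
  statements are identities between binary forms, modulo the equation of the root \<open>e\<close>.\<close>

lemma doubling_factor:
  assumes "elliptic_curve a b" "e ^ 3 + a * e + b = 0"
  shows "doubling a b = dual_isogeny_x e (- 3 * e ^ 2 - 4 * a) \<circ> isogeny_x e (3 * e ^ 2 + a)"
    and "doubling (isogenous_a a e) (isogenous_b a e) =
      isogeny_x e (3 * e ^ 2 + a) \<circ> dual_isogeny_x e (- 3 * e ^ 2 - 4 * a)"
proof -
  define t s where t: "t = 3 * e ^ 2 + a" and s: "s = - 3 * e ^ 2 - 4 * a"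
  define q where q: "q = 3 * e ^ 2 + 4 * a"
  have "t ^ 2 * q \<noteq> 0"
    using discriminant_factor[OF assms(2)] assms(1) by (simp only: elliptic_curve_def t q not_False_eq_True)
  moreover have "s = - q" by (simp add: s q)
  ultimately have "t \<noteq> 0" "s \<noteq> 0" by auto
  have "doubling a b x = dual_isogeny_x e s (isogeny_x e t x)" for x
  proof (cases x)
    case (Fin z)
    have nz: "z ^ 2 - e * z + t \<noteq> 0 \<or> z - e \<noteq> 0"
      using \<open>t \<noteq> 0\<close> by (auto simp: power2_eq_square)
    have "(z ^ 2 - e * z + t) ^ 2 + 2 * e * (z ^ 2 - e * z + t) * (z - e) + s * (z - e) ^ 2
        = z ^ 4 - 2 * a * z ^ 2 - 8 * b * z + a ^ 2"
      "4 * ((z ^ 2 - e * z + t) + 2 * e * (z - e)) * (z - e) = 4 * (z ^ 3 + a * z + b)"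
      using assms(2) unfolding t s by algebra+
    thus ?thesis
      using Fin dual_isogeny_x_cp1_of[OF nz, of e s] by (simp add: doubling_Fin isogeny_x_simps)
  qed (simp add: isogeny_x_simps dual_isogeny_x_simps)
  thus "doubling a b = dual_isogeny_x e s \<circ> isogeny_x e t" by auto
  define a' b' where a': "a' = isogenous_a a e" and b': "b' = isogenous_b a e"
  have "doubling a' b' x = isogeny_x e t (dual_isogeny_x e s x)" for x
  proof (cases x)
    case (Fin z)
    have nz: "z ^ 2 + 2 * e * z + s \<noteq> 0 \<or> 4 * (z + 2 * e) \<noteq> 0"
    proof (rule ccontr)
      assume "\<not> ?thesis"
      hence "z ^ 2 + 2 * e * z + s = 0" "4 * (z + 2 * e) = 0" by blast+
      hence "s = 0" by algebra
      thus False using \<open>s \<noteq> 0\<close> by simp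
    qed
    have "(z ^ 2 + 2 * e * z + s) ^ 2 - e * (z ^ 2 + 2 * e * z + s) * (4 * (z + 2 * e)) + t * (4 * (z + 2 * e)) ^ 2
        = z ^ 4 - 2 * a' * z ^ 2 - 8 * b' * z + a' ^ 2"
      "((z ^ 2 + 2 * e * z + s) - e * (4 * (z + 2 * e))) * (4 * (z + 2 * e)) = 4 * (z ^ 3 + a' * z + b')"
      unfolding t s a' b' isogenous_a_def isogenous_b_def by algebra+
    thus ?thesis
      using Fin isogeny_x_cp1_of[OF nz, of e t] by (simp add: doubling_Fin dual_isogeny_x_simps)
  qed (simp add: isogeny_x_simps dual_isogeny_x_simps)
  thus "doubling a' b' = isogeny_x e t \<circ> dual_isogeny_x e s" by auto
qed

text \<open>With \<open>p = 3 e\<^sup>2 + a\<close> and \<open>q = 3 e\<^sup>2 + 4 a\<close> the values of \<open>4 a\<^sup>3 + 27 b\<^sup>2\<close> for the two curves are \<open>p\<^sup>2 q\<close> and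
  \<open>- 16 q\<^sup>2 p\<close>, and \<open>a\<close> and \<open>isogenous_a a e\<close> are linear in \<open>p, q\<close>. So the invariants are homogeneous of
  degree zero in \<open>p, q\<close>, that is, functions of \<open>h = q / p\<close>.\<close>

lemma isogenous_j_invariants:
  assumes "elliptic_curve a b" "e ^ 3 + a * e + b = 0"
  defines "h \<equiv> (3 * e ^ 2 + 4 * a) / (3 * e ^ 2 + a)"
  shows "elliptic_curve (isogenous_a a e) (isogenous_b a e)"
    and "h \<noteq> 0" and "j_invariant a b = 256 * (h - 1) ^ 3 / h"
    and "j_invariant (isogenous_a a e) (isogenous_b a e) = 16 * (16 - h) ^ 3 / h ^ 2"
proof -
  define p q where p: "p = 3 * e ^ 2 + a" and q: "q = 3 * e ^ 2 + 4 * a"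
  have pq: "p \<noteq> 0" "q \<noteq> 0"
    using discriminant_factor[OF assms(2)] assms(1) by (auto simp: p q elliptic_curve_def)
  have h: "h = q / p" by (simp add: h_def p q)
  show "h \<noteq> 0" using h pq by simp
  show "elliptic_curve (isogenous_a a e) (isogenous_b a e)"
    using pq unfolding elliptic_curve_def isogenous_discriminant p[symmetric] q[symmetric] by simp
  have a: "a = (q - p) / 3" by (simp add: p q)
  have h1: "h - 1 = (q - p) / p" "16 - h = (16 * p - q) / p" using pq by (simp_all add: h field_simps)
  have "j_invariant a b = 1728 * (4 * ((q - p) / 3) ^ 3) / (p ^ 2 * q)"
    unfolding j_invariant_def discriminant_factor[OF assms(2)] p[symmetric] q[symmetric]
    by (simp only: a)
  also have "\<dots> = 256 * (h - 1) ^ 3 / h"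
    using pq unfolding h1 h by (simp add: field_simps power3_eq_cube power2_eq_square)
  finally show "j_invariant a b = 256 * (h - 1) ^ 3 / h" .
  have a': "isogenous_a a e = - (16 * p - q) / 3" unfolding isogenous_a_def p q by simp
  have "j_invariant (isogenous_a a e) (isogenous_b a e) = 1728 * (4 * (- (16 * p - q) / 3) ^ 3) / (- 16 * q ^ 2 * p)"
    unfolding j_invariant_def isogenous_discriminant p[symmetric] q[symmetric] unfolding a' by simp
  also have "\<dots> = 16 * (16 - h) ^ 3 / h ^ 2"
    using pq unfolding h1 h by (simp add: field_simps power3_eq_cube power2_eq_square)
  finally show "j_invariant (isogenous_a a e) (isogenous_b a e) = 16 * (16 - h) ^ 3 / h ^ 2" .
qed

lemma curve_with_parameter:
  assumes "h \<noteq> 0"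
  obtains a b e where "elliptic_curve a b" "e ^ 3 + a * e + b = 0"
    "(3 * e ^ 2 + 4 * a) / (3 * e ^ 2 + a) = h"
proof -
  \<comment> \<open>The solution of \<open>3 e\<^sup>2 + a = 1\<close> and \<open>3 e\<^sup>2 + 4 a = h\<close>.\<close>
  define a e where a: "a = (h - 1) / 3" and e: "e = csqrt ((4 - h) / 9)"
  define b where b: "b = - (e ^ 3) - a * e"
  have "e ^ 2 = (4 - h) / 9" by (simp add: e)
  hence *: "3 * e ^ 2 + a = 1" "3 * e ^ 2 + 4 * a = h" by (simp_all add: a field_simps)
  have root: "e ^ 3 + a * e + b = 0" by (simp add: b)
  show ?thesis
    using that[OF _ root] discriminant_factor[OF root] * assms by (simp add: elliptic_curve_def)
qed

text \<open>Equal invariants mean \<open>a\<^sup>3 b'\<^sup>2 = a'\<^sup>3 b\<^sup>2\<close>. Generically the scaling factor is \<open>b' a / (b a')\<close>; if \<open>a\<close> or \<open>b\<close>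
  vanishes, a cube root or a square root takes its place.\<close>

lemma isomorphic_curves:
  assumes "elliptic_curve a b" "elliptic_curve a' b'" "j_invariant a b = j_invariant a' b'"
  obtains r where "r \<noteq> 0" "a' = r ^ 2 * a" "b' = r ^ 3 * b"
proof -
  have "a ^ 3 * (4 * a' ^ 3 + 27 * b' ^ 2) = a' ^ 3 * (4 * a ^ 3 + 27 * b ^ 2)"
    using assms by (simp add: j_invariant_def elliptic_curve_def frac_eq_eq mult.commute)
  hence eq: "a ^ 3 * b' ^ 2 = a' ^ 3 * b ^ 2" by algebra
  consider "a = 0" | "a \<noteq> 0" "b = 0" | "a \<noteq> 0" "b \<noteq> 0" by blast
  thus ?thesis
  proof cases
    case 1
    hence "b \<noteq> 0" "a' = 0" "b' \<noteq> 0" using assms(1,2) eq by (auto simp: elliptic_curve_def)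
    obtain r where "r ^ 3 = b' / b"
      using nth_root_exists[of 3 "b' / b"] by auto
    moreover from this have "r \<noteq> 0" using \<open>b \<noteq> 0\<close> \<open>b' \<noteq> 0\<close> by auto
    ultimately show ?thesis using that[of r] 1 \<open>b \<noteq> 0\<close> \<open>a' = 0\<close> \<open>b' \<noteq> 0\<close> by auto
  next
    case 2
    hence "b' = 0" "a' \<noteq> 0" using assms(1,2) eq by (auto simp: elliptic_curve_def)
    moreover have "csqrt (a' / a) ^ 2 = a' / a" by simp
    ultimately show ?thesis using that[of "csqrt (a' / a)"] 2 by simp
  next
    case 3
    hence "a' \<noteq> 0" "b' \<noteq> 0" using assms(2) eq by (auto simp: elliptic_curve_def)
    define r where "r = b' * a / (b * a')"
    have r2: "r ^ 2 = a' / a"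
    proof -
      have "(b' * a) ^ 2 * a = a' * (b * a') ^ 2" using eq by algebra
      thus ?thesis using 3 \<open>a' \<noteq> 0\<close> by (simp add: r_def power_divide frac_eq_eq)
    qed
    have "r ^ 3 = a' / a * r" using r2 by (simp add: power3_eq_cube power2_eq_square)
    also have "\<dots> = b' / b" using 3 \<open>a' \<noteq> 0\<close> by (simp add: r_def)
    finally have "b' = r ^ 3 * b" using 3 by simp
    moreover have "a' = r ^ 2 * a" using r2 3 by simp
    moreover have "r \<noteq> 0" using 3 \<open>b' \<noteq> 0\<close> \<open>a' \<noteq> 0\<close> by (simp add: r_def)
    ultimately show ?thesis using that by blast
  qed
qed

section \<open>Functions on a Weierstrass curve\<close>

fun x_coord :: "epoint \<Rightarrow> cp1" where
  "x_coord Origin = Infty"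
| "x_coord (Aff x y) = Fin x"

lemma Aff_in_curve [simp]: "Aff x y \<in> curve a b \<longleftrightarrow> y ^ 2 = x ^ 3 + a * x + b"
  by (auto simp: curve_def)

lemma cubic_root_ex:
  obtains e :: complex where "e ^ 3 + a * e + b = 0"
proof -
  obtain u1 u2 u3 where "u1 + u2 + u3 = - 0" "u1 * u2 + u1 * u3 + u2 * u3 = a" "u1 * u2 * u3 = - b"
    by (rule cubic_roots)
  hence "u1 ^ 3 + a * u1 + b = 0" by algebra
  thus ?thesis by (rule that)
qed

lemma finite_cubic_roots: "finite {x :: complex. x ^ 3 + a * x + b = 0}"
proof -
  have "poly [:b, a, 0, 1:] x = x ^ 3 + a * x + b" for x
    by (simp add: algebra_simps power3_eq_cube)
  moreover have "finite {x. poly [:b, a, 0, 1:] x = 0}" by (rule poly_roots_finite) simp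
  ultimately show ?thesis by (simp only:)
qed

lemma doubling_x_coord:
  assumes "elliptic_curve a b" "P \<in> curve a b"
  shows "doubling a b (x_coord P) = x_coord (ell_add a P P)"
proof (cases P)
  case (Aff x y)
  have xy: "y ^ 2 = x ^ 3 + a * x + b" using assms(2) Aff by simp
  show ?thesis
  proof (cases "y = 0")
    case True
    thus ?thesis using Aff xy by (simp add: doubling_Fin cp1_of_def)
  next
    case False
    hence "y \<noteq> - y" by simp
    have "x ^ 4 - 2 * a * x ^ 2 - 8 * b * x + a ^ 2 = (3 * x ^ 2 + a) ^ 2 - 8 * x * y ^ 2"
      unfolding xy by algebra
    hence "doubling a b (Fin x) = Fin (((3 * x ^ 2 + a) ^ 2 - 8 * x * y ^ 2) / (4 * y ^ 2))"
      using False by (simp add: doubling_Fin cp1_of_def flip: xy)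
    also have "((3 * x ^ 2 + a) ^ 2 - 8 * x * y ^ 2) / (4 * y ^ 2) = ((3 * x ^ 2 + a) / (2 * y)) ^ 2 - x - x"
      using False by (simp add: power_divide diff_divide_distrib power_mult_distrib)
    finally show ?thesis using Aff \<open>y \<noteq> - y\<close> False by (simp add: Let_def)
  qed
qed simp

text \<open>The norm \<open>A\<^sup>2 - (x\<^sup>3 + a x + b) B\<^sup>2\<close> of \<open>A + y B\<close> vanishes wherever \<open>A + y B\<close> does. It is a nonzero
  polynomial, since its two terms have degrees of different parity.\<close>

lemma curve_function_zeros_finite:
  fixes A B :: "complex poly"
  assumes "A \<noteq> 0 \<or> B \<noteq> 0"
  shows "finite {x. \<exists>y. y ^ 2 = x ^ 3 + a * x + b \<and> poly A x + y * poly B x = 0}"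
proof -
  let ?f = "[:b, a, 0, 1:]"
  have f: "poly ?f x = x ^ 3 + a * x + b" for x
    by (simp add: algebra_simps power3_eq_cube)
  have "A * A - ?f * (B * B) \<noteq> 0"
  proof
    assume "A * A - ?f * (B * B) = 0"
    hence eq: "A * A = ?f * (B * B)" by simp
    have "?f \<noteq> 0" by simp
    hence "A = 0 \<longleftrightarrow> B = 0" using arg_cong[OF eq, of "\<lambda>p. p = 0"]
      by (simp only: mult_eq_0_iff simp_thms)
    hence "A \<noteq> 0" "B \<noteq> 0" using assms by blast+
    have "degree (A * A) = 2 * degree A" using \<open>A \<noteq> 0\<close> by (simp add: degree_mult_eq)
    moreover have "degree (?f * (B * B)) = degree ?f + degree (B * B)"
      using \<open>B \<noteq> 0\<close> by (intro degree_mult_eq) auto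
    moreover have "degree (B * B) = 2 * degree B" using \<open>B \<noteq> 0\<close> by (simp add: degree_mult_eq)
    ultimately have "2 * degree A = 3 + 2 * degree B" using eq by simp
    thus False by presburger
  qed
  moreover have "{x. \<exists>y. y ^ 2 = x ^ 3 + a * x + b \<and> poly A x + y * poly B x = 0}
      \<subseteq> {x. poly (A * A - ?f * (B * B)) x = 0}"
  proof clarify
    fix x y assume xy: "y ^ 2 = x ^ 3 + a * x + b" "poly A x + y * poly B x = 0"
    have "poly (A * A - ?f * (B * B)) x = poly A x * poly A x - y ^ 2 * (poly B x * poly B x)"
      unfolding xy(1) f[symmetric] by (simp only: poly_mult poly_diff)
    also have "\<dots> = 0" using xy(2) by algebra
    finally show "poly (A * A - ?f * (B * B)) x = 0" .
  qed
  ultimately show ?thesis using poly_roots_finite finite_subset by blast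
qed

text \<open>The functions of the form \<open>A(x) + y B(x)\<close> are closed under sums and under multiplication by \<open>x\<close> and
  by \<open>y\<close>, as \<open>y\<^sup>2\<close> is a polynomial in \<open>x\<close> on the curve; so they contain all monomials.\<close>

lemma form_on_curve:
  "\<exists>A B. \<forall>x y. y ^ 2 = x ^ 3 + a * x + b \<longrightarrow> form_value d c x y 1 = poly A x + y * poly B x"
proof -
  define fn :: "(complex \<Rightarrow> complex \<Rightarrow> complex) \<Rightarrow> bool" where
    "fn g \<longleftrightarrow> (\<exists>A B. \<forall>x y. y ^ 2 = x ^ 3 + a * x + b \<longrightarrow> g x y = poly A x + y * poly B x)" for g
  have const: "fn (\<lambda>x y. k)" for k
    unfolding fn_def by (rule exI[of _ "[:k:]"], rule exI[of _ 0]) simp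
  have add: "fn (\<lambda>x y. g x y + h x y)" if gh: "fn g" "fn h" for g h
  proof -
    obtain A B where g: "\<And>x y. y ^ 2 = x ^ 3 + a * x + b \<Longrightarrow> g x y = poly A x + y * poly B x"
      using gh(1) unfolding fn_def by auto
    obtain C E where h: "\<And>x y. y ^ 2 = x ^ 3 + a * x + b \<Longrightarrow> h x y = poly C x + y * poly E x"
      using gh(2) unfolding fn_def by auto
    show ?thesis unfolding fn_def
      by (rule exI[of _ "A + C"], rule exI[of _ "B + E"]) (simp add: g h algebra_simps)
  qed
  have mult_x: "fn (\<lambda>x y. g x y * x)" if "fn g" for g
  proof -
    obtain A B where g: "\<And>x y. y ^ 2 = x ^ 3 + a * x + b \<Longrightarrow> g x y = poly A x + y * poly B x"
      using \<open>fn g\<close> unfolding fn_def by auto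
    show ?thesis unfolding fn_def
      by (rule exI[of _ "pCons 0 A"], rule exI[of _ "pCons 0 B"]) (simp add: g algebra_simps)
  qed
  have mult_y: "fn (\<lambda>x y. g x y * y)" if "fn g" for g
  proof -
    obtain A B where g: "\<And>x y. y ^ 2 = x ^ 3 + a * x + b \<Longrightarrow> g x y = poly A x + y * poly B x"
      using \<open>fn g\<close> unfolding fn_def by auto
    have "(poly A x + y * poly B x) * y = poly ([:b, a, 0, 1:] * B) x + y * poly A x"
      if "y ^ 2 = x ^ 3 + a * x + b" for x y
    proof -
      have "poly ([:b, a, 0, 1:] * B) x = (x ^ 3 + a * x + b) * poly B x"
        by (simp add: algebra_simps power3_eq_cube)
      thus ?thesis using that by algebra
    qed
    thus ?thesis unfolding fn_def
      by (intro exI[of _ "[:b, a, 0, 1:] * B"] exI[of _ A]) (simp add: g)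
  qed
  have mono: "fn (\<lambda>x y. k * x ^ i * y ^ l)" for k i l
  proof (induction l)
    case 0
    show ?case
    proof (induction i)
      case 0 show ?case using const[of k] by simp
    next
      case (Suc i) thus ?case using mult_x[OF Suc] by (simp add: mult_ac)
    qed
  next
    case (Suc l) thus ?case using mult_y[OF Suc] by (simp add: mult_ac)
  qed
  have sum: "fn (\<lambda>x y. \<Sum>i\<in>I. g i x y)" if "finite I" "\<And>i. fn (g i)" for I :: "nat set" and g
    using that(1) by induction (auto intro: add const[of 0] that(2))
  have "fn (\<lambda>x y. form_value d c x y 1)"
    unfolding form_value_def power_one mult_1_right
    by (intro sum) (auto intro: sum mono)
  thus ?thesis unfolding fn_def .
qed

section \<open>Even morphisms factor through the x-coordinate\<close>

text \<open>Near the given point \<open>\<pi> = [A + y B : C + y E]\<close>. Comparing the values at \<open>y\<close> and \<open>- y\<close> gives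
  \<open>B C = A E\<close>, so the ratio equals \<open>[A : C]\<close> or, if this pair vanishes identically, \<open>[B : E]\<close>. After
  division by the gcd it is defined everywhere. The map \<open>R\<close> found here might depend on the point;
  agreement up to finitely many x-coordinates is what later identifies the maps of different points.\<close>

lemma even_morphism_chart:
  assumes \<pi>: "morphism_to_cp1 a b \<pi>" and even: "\<forall>P\<in>curve a b. \<pi> (ell_neg P) = \<pi> P"
    and P: "y0 ^ 2 = x0 ^ 3 + a * x0 + b"
  obtains d R where "morphism d R" "\<pi> (Aff x0 y0) = R (Fin x0)"
    "finite {x. \<exists>y. y ^ 2 = x ^ 3 + a * x + b \<and> \<pi> (Aff x y) \<noteq> R (Fin x)}"
proof -
  obtain d F G where FG0: "form_at d F (Aff x0 y0) \<noteq> 0 \<or> form_at d G (Aff x0 y0) \<noteq> 0"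
    and FG: "\<forall>Q\<in>curve a b. form_at d F Q \<noteq> 0 \<or> form_at d G Q \<noteq> 0 \<longrightarrow>
           \<pi> Q = cp1_of (form_at d F Q) (form_at d G Q)"
    using \<pi> P unfolding morphism_to_cp1_def by (metis Aff_in_curve)
  obtain A B where F: "\<And>x y. y ^ 2 = x ^ 3 + a * x + b \<Longrightarrow> form_value d F x y 1 = poly A x + y * poly B x"
    using form_on_curve[of a b d F] by blast
  obtain C E where G: "\<And>x y. y ^ 2 = x ^ 3 + a * x + b \<Longrightarrow> form_value d G x y 1 = poly C x + y * poly E x"
    using form_on_curve[of a b d G] by blast
  have chart: "\<pi> (Aff x y) = cp1_of (poly A x + y * poly B x) (poly C x + y * poly E x)"
    if "y ^ 2 = x ^ 3 + a * x + b" "poly A x + y * poly B x \<noteq> 0 \<or> poly C x + y * poly E x \<noteq> 0" for x y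
    using FG[rule_format, of "Aff x y"] that by (simp add: F G)
  have nz: "A \<noteq> 0 \<or> B \<noteq> 0 \<or> C \<noteq> 0 \<or> E \<noteq> 0" using FG0 P by (auto simp: F G)
  define S where "S = {x. \<exists>y. y ^ 2 = x ^ 3 + a * x + b \<and> poly A x + y * poly B x = 0
      \<and> poly C x + y * poly E x = 0}"
  have S: "finite S"
  proof (cases "A \<noteq> 0 \<or> B \<noteq> 0")
    case True
    show ?thesis
      by (rule finite_subset[OF _ curve_function_zeros_finite[OF True, of a b]]) (auto simp: S_def)
  next
    case False
    hence "C \<noteq> 0 \<or> E \<noteq> 0" using nz by blast
    show ?thesis
      by (rule finite_subset[OF _ curve_function_zeros_finite[OF \<open>C \<noteq> 0 \<or> E \<noteq> 0\<close>, of a b]])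
        (auto simp: S_def)
  qed
  \<comment> \<open>Outside the finite set \<open>S\<close> of common zeros, evenness compares the chart at \<open>(x, y)\<close> and \<open>(x, - y)\<close>.\<close>
  have "B * C - A * E = 0"
  proof (rule poly_eq_0_cofinite)
    show "finite (S \<union> {x. x ^ 3 + a * x + b = 0})" using S finite_cubic_roots by simp
    fix x assume x: "x \<notin> S \<union> {x. x ^ 3 + a * x + b = 0}"
    define y where "y = csqrt (x ^ 3 + a * x + b)"
    have y: "y ^ 2 = x ^ 3 + a * x + b" "(- y) ^ 2 = x ^ 3 + a * x + b" by (simp_all add: y_def)
    have "y \<noteq> 0" using x y by auto
    have nz: "poly A x + y * poly B x \<noteq> 0 \<or> poly C x + y * poly E x \<noteq> 0"
      "poly A x + (- y) * poly B x \<noteq> 0 \<or> poly C x + (- y) * poly E x \<noteq> 0"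
      using x y unfolding S_def by blast+
    have "\<pi> (Aff x (- y)) = \<pi> (Aff x y)"
      using even[rule_format, of "Aff x y"] y by simp
    hence "cp1_of (poly A x + y * poly B x) (poly C x + y * poly E x)
        = cp1_of (poly A x + (- y) * poly B x) (poly C x + (- y) * poly E x)"
      using chart[OF y(1) nz(1)] chart[OF y(2) nz(2)] by simp
    hence "(poly A x + y * poly B x) * (poly C x + (- y) * poly E x)
        = (poly A x + (- y) * poly B x) * (poly C x + y * poly E x)"
      unfolding cp1_of_eq_iff[OF nz] .
    hence "2 * y * (poly B x * poly C x - poly A x * poly E x) = 0" by algebra
    thus "poly (B * C - A * E) x = 0" using \<open>y \<noteq> 0\<close> by simp
  qed
  hence BC: "B * C = A * E" by simp
  obtain p0 q0 where pq0: "p0 \<noteq> 0 \<or> q0 \<noteq> 0" "A * q0 = p0 * C" "B * q0 = p0 * E"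
  proof (cases "A \<noteq> 0 \<or> C \<noteq> 0")
    case True
    thus ?thesis using that[of A C] BC by (simp add: mult.commute)
  next
    case False
    thus ?thesis using that[of B E] nz by (simp add: mult.commute)
  qed
  define g where "g = gcd p0 q0"
  have "g \<noteq> 0" using pq0(1) by (simp add: g_def)
  then obtain p q where pq: "p0 = p * g" "q0 = q * g" "coprime p q"
    using gcd_coprime_exists[of p0 q0] unfolding g_def by blast
  have pqA: "A * q = p * C" "B * q = p * E"
    using pq0(2,3) \<open>g \<noteq> 0\<close> unfolding pq by (simp_all add: mult.assoc[symmetric] mult.commute[of _ g] mult.left_commute[of _ g])
  let ?d = "max (degree p) (degree q)"
  have ncz: "no_common_zero ?d p q" using pq pq0(1) by (intro coprime_no_common_zero) auto
  define R where "R = hom_map ?d p q"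
  have "morphism ?d R" unfolding morphism_def R_def using ncz by blast
  moreover have eq: "\<pi> (Aff x y) = R (Fin x)"
    if "y ^ 2 = x ^ 3 + a * x + b" "poly A x + y * poly B x \<noteq> 0 \<or> poly C x + y * poly E x \<noteq> 0" for x y
  proof -
    have "poly A x * poly q x = poly p x * poly C x" "poly B x * poly q x = poly p x * poly E x"
      using pqA by (metis poly_mult)+
    hence "(poly A x + y * poly B x) * poly q x = poly p x * (poly C x + y * poly E x)" by algebra
    thus ?thesis unfolding R_def hom_map.simps chart[OF that]
      using ncz that(2) by (subst cp1_of_eq_iff) (auto simp: no_common_zero_def)
  qed
  moreover have "finite {x. \<exists>y. y ^ 2 = x ^ 3 + a * x + b \<and> \<pi> (Aff x y) \<noteq> R (Fin x)}"
    by (rule finite_subset[OF _ S]) (use eq in \<open>auto simp: S_def\<close>)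
  moreover have "\<pi> (Aff x0 y0) = R (Fin x0)" using eq[OF P] FG0 P by (simp add: F G)
  ultimately show ?thesis using that by blast
qed

text \<open>The maps obtained from any two points agree at all but finitely many arguments, hence are equal.\<close>

lemma even_morphism_factors:
  assumes "morphism_to_cp1 a b \<pi>" "\<forall>P\<in>curve a b. \<pi> (ell_neg P) = \<pi> P"
  obtains d R where "morphism d R" "\<And>x y. y ^ 2 = x ^ 3 + a * x + b \<Longrightarrow> \<pi> (Aff x y) = R (Fin x)"
proof -
  let ?bad = "\<lambda>R. {x. \<exists>y. y ^ 2 = x ^ 3 + a * x + b \<and> \<pi> (Aff x y) \<noteq> R (Fin x)}"
  have y0: "(csqrt b) ^ 2 = 0 ^ 3 + a * 0 + b" by simp
  obtain d R where "morphism d R" "\<pi> (Aff 0 (csqrt b)) = R (Fin 0)" "finite (?bad R)"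
    using assms y0 by (rule even_morphism_chart)
  note R = this(1,3)
  have "\<pi> (Aff x y) = R (Fin x)" if xy: "y ^ 2 = x ^ 3 + a * x + b" for x y
  proof -
    obtain d' R' where R': "morphism d' R'" "\<pi> (Aff x y) = R' (Fin x)" "finite (?bad R')"
      using assms xy by (rule even_morphism_chart)
    have "R = R'"
    proof (rule morphism_identity[OF R(1) R'(1)])
      show "finite (?bad R \<union> ?bad R')" using R(2) R'(3) by simp
      fix z assume z: "z \<notin> ?bad R \<union> ?bad R'"
      define v where "v = csqrt (z ^ 3 + a * z + b)"
      have "v ^ 2 = z ^ 3 + a * z + b" by (simp add: v_def)
      hence "\<pi> (Aff z v) = R (Fin z)" "\<pi> (Aff z v) = R' (Fin z)" using z by blast+
      thus "R (Fin z) = R' (Fin z)" by simp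
    qed
    thus ?thesis using R'(2) by simp
  qed
  thus ?thesis using that R(1) by blast
qed

text \<open>Away from \<open>\<infinity>\<close> and the roots of the cubic the x-coordinate is two to one.\<close>

lemma generic_fibre_x_coord:
  assumes "morphism d R"
  shows "generic_fibre (curve a b) (R \<circ> x_coord) (2 * d)"
proof -
  let ?f = "\<lambda>x. x ^ 3 + a * x + b"
  let ?B = "{w. \<not> (finite {x \<in> UNIV. R x = w} \<and> card {x \<in> UNIV. R x = w} = d)}
    \<union> insert (R Infty) ((\<lambda>x. R (Fin x)) ` {x. ?f x = 0})"
  have fin: "finite ?B"
    using generic_fibre_morphism[OF assms] finite_cubic_roots by (simp add: generic_fibre_def)
  have "finite {P \<in> curve a b. (R \<circ> x_coord) P = w} \<and> card {P \<in> curve a b. (R \<circ> x_coord) P = w} = 2 * d"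
    if w: "w \<notin> ?B" for w
  proof -
    define Z where "Z = {z. R (Fin z) = w}"
    have "{x. R x = w} = Fin ` Z"
    proof (rule set_eqI)
      show "x \<in> {x. R x = w} \<longleftrightarrow> x \<in> Fin ` Z" for x
        using w by (cases x) (auto simp: Z_def)
    qed
    moreover have inj: "inj_on Fin Z" by (auto simp: inj_on_def)
    ultimately have Z: "finite Z" "card Z = d"
      using w by (auto simp: card_image finite_image_iff)
    define h where "h = (\<lambda>(z, s). Aff z (s * csqrt (?f z)))"
    have nz: "csqrt (?f z) \<noteq> 0" if "z \<in> Z" for z using w that by (auto simp: Z_def)
    have "{P \<in> curve a b. (R \<circ> x_coord) P = w} = h ` (Z \<times> {1, -1})"
    proof (rule set_eqI)
      fix P
      show "P \<in> {P \<in> curve a b. (R \<circ> x_coord) P = w} \<longleftrightarrow> P \<in> h ` (Z \<times> {1, -1})"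
      proof (cases P)
        case Origin
        thus ?thesis using w by (auto simp: h_def)
      next
        case (Aff x y)
        have "y ^ 2 = ?f x \<longleftrightarrow> y = csqrt (?f x) \<or> y = - csqrt (?f x)"
          by (metis power2_csqrt power2_eq_iff)
        thus ?thesis using Aff by (auto simp: h_def Z_def image_iff)
      qed
    qed
    moreover have "inj_on h (Z \<times> {1, -1})"
      using nz by (auto simp: inj_on_def h_def)
    ultimately show ?thesis using Z by (simp add: card_image card_cartesian_product)
  qed
  hence "{w. \<not> (finite {P \<in> curve a b. (R \<circ> x_coord) P = w} \<and> card {P \<in> curve a b. (R \<circ> x_coord) P = w} = 2 * d)} \<subseteq> ?B"
    by blast
  thus ?thesis unfolding generic_fibre_def using fin by (rule finite_subset)
qed

section \<open>Lattes maps are the conjugates of doubling maps\<close>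

text \<open>At the affine points the x-coordinate is \<open>[X : Z]\<close>. Both forms vanish at the origin, where the
  equation of the curve provides the second chart \<open>[Y\<^sup>2 - a X Z - b Z\<^sup>2 : X\<^sup>2]\<close>.\<close>

lemma morphism_to_cp1_x_coord:
  assumes "morphism 1 M"
  shows "morphism_to_cp1 a b (M \<circ> x_coord)"
  unfolding morphism_to_cp1_def
proof
  obtain \<alpha> \<beta> \<gamma> \<delta> where det: "\<alpha> * \<delta> - \<beta> * \<gamma> \<noteq> 0" and M: "M = moebius \<alpha> \<beta> \<gamma> \<delta>"
    using assms by (rule morphism_1_moebius)
  fix P assume P: "P \<in> curve a b"
  show "\<exists>d F G. (form_at d F P \<noteq> 0 \<or> form_at d G P \<noteq> 0) \<and>
        (\<forall>Q\<in>curve a b. form_at d F Q \<noteq> 0 \<or> form_at d G Q \<noteq> 0 \<longrightarrow>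
           (M \<circ> x_coord) Q = cp1_of (form_at d F Q) (form_at d G Q))"
  proof (cases P)
    case (Aff x0 y0)
    define c :: "complex \<Rightarrow> complex \<Rightarrow> nat \<Rightarrow> nat \<Rightarrow> complex" where
      "c u v i k = (if k = 0 then if i = 0 then v else u else 0)" for u v i k
    have c: "form_value 1 (c u v) X Y Z = u * X + v * Z" for u v X Y Z
      by (simp add: form_value_def c_def)
    have "\<alpha> * x0 + \<beta> \<noteq> 0 \<or> \<gamma> * x0 + \<delta> \<noteq> 0"
    proof (rule ccontr)
      assume "\<not> ?thesis"
      hence "\<alpha> * \<delta> - \<beta> * \<gamma> = 0" by algebra
      thus False using det by simp
    qed
    moreover have "(M \<circ> x_coord) Q = cp1_of (form_at 1 (c \<alpha> \<beta>) Q) (form_at 1 (c \<gamma> \<delta>) Q)"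
      if "form_at 1 (c \<alpha> \<beta>) Q \<noteq> 0 \<or> form_at 1 (c \<gamma> \<delta>) Q \<noteq> 0" for Q
      using that c by (cases Q) (simp_all add: M)
    ultimately show ?thesis using Aff c
      by (intro exI[of _ 1] exI[of _ "c \<alpha> \<beta>"] exI[of _ "c \<gamma> \<delta>"]) simp
  next
    case Origin
    define c :: "complex \<Rightarrow> complex \<Rightarrow> nat \<Rightarrow> nat \<Rightarrow> complex" where
      "c u v i k = (if i = 2 then v else if k = 2 then u else if k = 0 then
        (if i = 1 then - a * u else - b * u) else 0)" for u v i k
    have c: "form_value 2 (c u v) X Y Z = u * (Y ^ 2 - a * X * Z - b * Z ^ 2) + v * X ^ 2" for u v X Y Z
      by (simp add: form_value_def c_def eval_nat_numeral algebra_simps)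
    have "\<alpha> \<noteq> 0 \<or> \<gamma> \<noteq> 0" using det by auto
    moreover have "(M \<circ> x_coord) Q = cp1_of (form_at 2 (c \<alpha> \<beta>) Q) (form_at 2 (c \<gamma> \<delta>) Q)"
      if "Q \<in> curve a b" "form_at 2 (c \<alpha> \<beta>) Q \<noteq> 0 \<or> form_at 2 (c \<gamma> \<delta>) Q \<noteq> 0" for Q
    proof (cases Q)
      case (Aff x y)
      have xy: "y ^ 2 = x ^ 3 + a * x + b" using that(1) Aff by simp
      have form: "form_at 2 (c u v) Q = x ^ 2 * (u * x + v)" for u v
        unfolding Aff form_at.simps c xy power_one mult_1_right by algebra
      hence "x ^ 2 \<noteq> 0" using that(2) by auto
      thus ?thesis unfolding form using Aff M by (simp add: cp1_of_scale)
    qed (simp add: c M)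
    ultimately show ?thesis using Origin c
      by (intro exI[of _ 2] exI[of _ "c \<alpha> \<beta>"] exI[of _ "c \<gamma> \<delta>"]) simp
  qed
qed

lemma lattes_map_conjugate_doubling:
  assumes "elliptic_curve a b" "morphism 1 \<mu>"
  shows "lattes_map (j_invariant a b) (\<mu> \<circ> doubling a b \<circ> inv \<mu>)"
proof -
  note inv = morphism_1_inv[OF assms(2)]
  have "morphism (1 * 4 * 1) (\<mu> \<circ> doubling a b \<circ> inv \<mu>)"
    by (intro morphism_comp assms morphism_doubling inv)
  hence "rational_function (\<mu> \<circ> doubling a b \<circ> inv \<mu>)"
    by (rule morphism_imp_rational_function) simp
  moreover have "has_degree a b (\<mu> \<circ> x_coord) 2"
    using generic_fibre_x_coord[OF assms(2), of a b] unfolding has_degree_def generic_fibre_def by simp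
  moreover have "(\<mu> \<circ> x_coord) (ell_neg P) = (\<mu> \<circ> x_coord) P" for P by (cases P) simp_all
  moreover have "(\<mu> \<circ> doubling a b \<circ> inv \<mu>) ((\<mu> \<circ> x_coord) P) = (\<mu> \<circ> x_coord) (ell_add a P P)"
    if "P \<in> curve a b" for P
    using doubling_x_coord[OF assms(1) that] inv(1) by (simp add: bij_is_inj)
  ultimately show ?thesis
    unfolding lattes_map_def using assms(1) morphism_to_cp1_x_coord[OF assms(2)] by blast
qed

text \<open>The factorization \<open>\<pi> = R \<circ> x_coord\<close> is known at the affine points only. At the origin it follows
  from the functional equation: \<open>L \<circ> R\<close> and \<open>R \<circ> doubling a b\<close> agree generically, hence everywhere, and
  evaluating them at a root \<open>e\<close> of the cubic compares \<open>\<pi> (2 (e, 0)) = \<pi> Origin\<close> with \<open>R Infty\<close>.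
  Counting generic fibres then shows that \<open>R\<close> has degree one.\<close>

lemma lattes_map_conjugateE:
  assumes "lattes_map j L"
  obtains a b \<mu> where "elliptic_curve a b" "j_invariant a b = j" "morphism 1 \<mu>"
    "L = \<mu> \<circ> doubling a b \<circ> inv \<mu>"
proof -
  obtain a b \<pi> where L: "rational_function L" and ab: "elliptic_curve a b" "j_invariant a b = j"
    and \<pi>: "morphism_to_cp1 a b \<pi>" "has_degree a b \<pi> 2" "\<forall>P\<in>curve a b. \<pi> (ell_neg P) = \<pi> P"
    and fe: "\<forall>P\<in>curve a b. L (\<pi> P) = \<pi> (ell_add a P P)"
    using assms unfolding lattes_map_def by blast
  obtain m where m: "morphism m L" using L rational_function_iff_morphism by blast
  obtain d R where R: "morphism d R"
    "\<And>x y. y ^ 2 = x ^ 3 + a * x + b \<Longrightarrow> \<pi> (Aff x y) = R (Fin x)"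
    using \<pi>(1,3) by (rule even_morphism_factors) blast
  have conj: "L \<circ> R = R \<circ> doubling a b"
  proof (rule morphism_identity[OF morphism_comp[OF m R(1)] morphism_comp[OF R(1) morphism_doubling[OF ab(1)]]])
    show "finite {x. x ^ 3 + a * x + b = 0}" by (rule finite_cubic_roots)
    fix x assume x: "x \<notin> {x. x ^ 3 + a * x + b = 0}"
    define y where "y = csqrt (x ^ 3 + a * x + b)"
    have y: "y ^ 2 = x ^ 3 + a * x + b" by (simp add: y_def)
    have "y \<noteq> 0" using x y by auto
    hence "doubling a b (Fin x) \<noteq> Infty"
      using x by (simp add: doubling_Fin cp1_of_def del: distrib_left_numeral)
    moreover have dbl: "doubling a b (Fin x) = x_coord (ell_add a (Aff x y) (Aff x y))"
      using doubling_x_coord[OF ab(1), of "Aff x y"] y by simp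
    ultimately obtain x' y' where xy': "ell_add a (Aff x y) (Aff x y) = Aff x' y'"
      by (cases "ell_add a (Aff x y) (Aff x y)") auto
    define m where "m = (3 * x ^ 2 + a) / (2 * y)"
    have "y \<noteq> - y" using \<open>y \<noteq> 0\<close> by simp
    hence *: "x' = m ^ 2 - x - x" "y' = m * (x - x') - y"
      using xy' \<open>y \<noteq> 0\<close> by (auto simp: Let_def m_def)
    have "2 * y * m = 3 * x ^ 2 + a" using \<open>y \<noteq> 0\<close> by (simp add: m_def)
    hence "y' ^ 2 = x' ^ 3 + a * x' + b" using y unfolding * by algebra
    hence "R (doubling a b (Fin x)) = \<pi> (ell_add a (Aff x y) (Aff x y))"
      unfolding dbl xy' by (simp add: R(2))
    also have "\<dots> = L (R (Fin x))"
      using fe[rule_format, of "Aff x y"] y R(2)[OF y] by simp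
    finally show "(L \<circ> R) (Fin x) = (R \<circ> doubling a b) (Fin x)" by simp
  qed
  obtain e where e: "e ^ 3 + a * e + b = 0" by (rule cubic_root_ex)
  \<comment> \<open>The doubling of the 2-torsion point \<open>(e, 0)\<close> is the origin.\<close>
  have "\<pi> Origin = L (\<pi> (Aff e 0))" using fe[rule_format, of "Aff e 0"] e by simp
  also have "\<dots> = L (R (Fin e))" using R(2)[of 0 e] e by simp
  also have "\<dots> = R (doubling a b (Fin e))" using conj by (metis comp_apply)
  also have "doubling a b (Fin e) = Infty" using e by (simp add: doubling_Fin cp1_of_def)
  finally have O: "\<pi> Origin = R Infty" .
  have "\<pi> P = (R \<circ> x_coord) P" if "P \<in> curve a b" for P
    using that R(2) O by (cases P) simp_all
  hence "{P \<in> curve a b. \<pi> P = w} = {P \<in> curve a b. (R \<circ> x_coord) P = w}" for w by auto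
  hence "generic_fibre (curve a b) (R \<circ> x_coord) 2"
    using \<pi>(2) unfolding has_degree_def generic_fibre_def by simp
  hence "2 * d = 2" using generic_fibre_x_coord[OF R(1)] by (rule generic_fibre_unique[rotated])
  hence R1: "morphism 1 R" using R(1) by simp
  have "L = \<mu>' \<circ> doubling a b \<circ> inv \<mu>'" if "\<mu>' = R" for \<mu>'
  proof
    fix x
    have "L (R (inv R x)) = R (doubling a b (inv R x))" using conj by (metis comp_apply)
    thus "L x = (\<mu>' \<circ> doubling a b \<circ> inv \<mu>') x"
      using morphism_1_inv(1)[OF R1] that by (simp add: bij_is_surj surj_f_inv_f)
  qed
  thus ?thesis using that[OF ab R1] by simp
qed

section \<open>Behaviour of the doubling map at infinity\<close>

definition affine_doubling :: "complex \<Rightarrow> complex \<Rightarrow> complex \<Rightarrow> complex" where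
  "affine_doubling a b x = (x ^ 4 - 2 * a * x ^ 2 - 8 * b * x + a ^ 2) / (4 * (x ^ 3 + a * x + b))"

lemma doubling_eq_affine_doubling: "x ^ 3 + a * x + b \<noteq> 0 \<Longrightarrow> doubling a b (Fin x) = Fin (affine_doubling a b x)"
  by (simp add: doubling_Fin cp1_of_def affine_doubling_def del: distrib_left_numeral)

lemma doubling_eq_Infty_iff: "doubling a b (Fin x) = Infty \<longleftrightarrow> x ^ 3 + a * x + b = 0"
  by (simp add: doubling_Fin cp1_of_def del: distrib_left_numeral)

lemma at_infinity_neq_bot: "(at_infinity :: complex filter) \<noteq> bot"
proof
  assume "(at_infinity :: complex filter) = bot"
  hence "\<forall>\<^sub>F x :: complex in at_infinity. False" by simp
  then obtain B where "\<And>x :: complex. B \<le> norm x \<Longrightarrow> False"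
    unfolding eventually_at_infinity by blast
  from this[of "of_real \<bar>B\<bar>"] show False using abs_ge_self[of B] by simp
qed

lemma eventually_notin_finite:
  "finite S \<Longrightarrow> \<forall>\<^sub>F x in at_infinity. x \<notin> (S :: complex set)"
proof -
  assume "finite S"
  hence "\<forall>\<^sub>F x in at_infinity. \<forall>y\<in>S. x \<noteq> y"
    by (rule eventually_ball_finite) (simp add: eventually_not_equal_at_infinity)
  thus ?thesis by (rule eventually_mono) blast
qed

lemma tendsto_inverse_infinity [tendsto_intros]: "(inverse \<longlongrightarrow> 0) (at_infinity :: complex filter)"
  by (rule tendsto_inverse_0)

text \<open>The multiplier of \<open>\<infinity>\<close> under doubling is 4 in the coordinate \<open>1/x\<close>. The comparisons at \<open>\<infinity>\<close> below
  rest on this leading term.\<close>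

lemma affine_doubling_tendsto: "((\<lambda>x. affine_doubling a b x / x) \<longlongrightarrow> 1 / 4) at_infinity"
proof (rule Lim_transform_eventually)
  let ?g = "\<lambda>z. (1 - 2 * a * z ^ 2 - 8 * b * z ^ 3 + a ^ 2 * z ^ 4) / (4 * (1 + a * z ^ 2 + b * z ^ 3))"
  have "((\<lambda>x. ?g (inverse x)) \<longlongrightarrow> ?g 0) at_infinity"
    by (intro tendsto_intros) simp
  thus "((\<lambda>x. ?g (inverse x)) \<longlongrightarrow> 1 / 4) at_infinity" by simp
  show "\<forall>\<^sub>F x in at_infinity. ?g (inverse x) = affine_doubling a b x / x"
    using eventually_not_equal_at_infinity[of 0]
  proof (rule eventually_mono)
    fix x :: complex assume x: "x \<noteq> 0"
    define z where "z = inverse x"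
    have xz: "x * z = 1" using x by (simp add: z_def)
    have n: "x ^ 4 - 2 * a * x ^ 2 - 8 * b * x + a ^ 2 = x ^ 4 * (1 - 2 * a * z ^ 2 - 8 * b * z ^ 3 + a ^ 2 * z ^ 4)"
      using xz by algebra
    have d: "4 * (x ^ 3 + a * x + b) * x = x ^ 4 * (4 * (1 + a * z ^ 2 + b * z ^ 3))"
      using xz by algebra
    show "?g (inverse x) = affine_doubling a b x / x"
      unfolding z_def[symmetric] affine_doubling_def divide_divide_eq_left n d
      using x by (intro mult_divide_mult_cancel_left[symmetric]) simp
  qed
qed

lemma affine_doubling_limit_unique:
  assumes "((\<lambda>x. affine_doubling a b x / x) \<longlongrightarrow> l) at_infinity"
  shows "l = 1 / 4"
  using assms affine_doubling_tendsto by (rule tendsto_unique[OF at_infinity_neq_bot])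

lemma filterlim_shift: "filterlim (\<lambda>x. x - c) at_infinity (at_infinity :: complex filter)"
  unfolding filterlim_at_infinity_conv_norm_at_top
proof -
  have "filterlim (\<lambda>x. - norm c + norm x) at_top (at_infinity :: complex filter)"
    by (rule filterlim_tendsto_add_at_top[OF tendsto_const filterlim_at_infinity_imp_norm_at_top])
      (rule filterlim_ident)
  thus "filterlim (\<lambda>x. norm (x - c)) at_top at_infinity"
  proof (rule filterlim_at_top_mono)
    show "\<forall>\<^sub>F x in at_infinity. - norm c + norm x \<le> norm (x - c)"
      using norm_triangle_ineq2[of _ c] by (auto intro!: always_eventually simp: algebra_simps)
  qed
qed

lemma filterlim_reflect: "filterlim (\<lambda>x. c - x) at_infinity (at_infinity :: complex filter)"
  using filterlim_shift[of c] unfolding filterlim_at_infinity_conv_norm_at_top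
  by (simp add: norm_minus_commute)

text \<open>The reflection would turn the leading term \<open>x/4\<close> into \<open>- x/4\<close>. Reflections are the deck
  involutions of quadratic polynomials, so these cannot be right factors of a doubling map.\<close>

lemma doubling_not_reflection_invariant:
  assumes "\<And>x. doubling a b (Fin (c - x)) = doubling a b (Fin x)"
  shows False
proof -
  let ?S = "{x. x ^ 3 + a * x + b = 0}"
  have "((\<lambda>x. affine_doubling a b (c - x) / (c - x) * (c * inverse x - 1)) \<longlongrightarrow> 1 / 4 * (c * 0 - 1)) at_infinity"
    by (intro tendsto_intros filterlim_compose[OF affine_doubling_tendsto filterlim_reflect])
  moreover have "\<forall>\<^sub>F x in at_infinity. affine_doubling a b (c - x) / (c - x) * (c * inverse x - 1) = affine_doubling a b x / x"
    using eventually_notin_finite[of "{0, c} \<union> ?S"] finite_cubic_roots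
  proof (simp, elim eventually_mono, safe)
    fix x assume x: "x \<noteq> 0" "x \<noteq> c" "x ^ 3 + a * x + b \<noteq> 0"
    have "(c - x) ^ 3 + a * (c - x) + b \<noteq> 0"
      using assms[of x] x(3) doubling_eq_Infty_iff by metis
    hence "affine_doubling a b (c - x) = affine_doubling a b x"
      using assms[of x] x(3) by (simp add: doubling_eq_affine_doubling)
    thus "affine_doubling a b (c - x) * (c * inverse x - 1) / (c - x) = affine_doubling a b x / x"
      using x by (simp add: field_simps)
  qed
  ultimately have "((\<lambda>x. affine_doubling a b x / x) \<longlongrightarrow> 1 / 4 * (c * 0 - 1)) at_infinity"
    by (rule Lim_transform_eventually)
  hence "1 / 4 * (c * 0 - 1) = 1 / 4" by (rule affine_doubling_limit_unique)
  thus False by simp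
qed

text \<open>Near \<open>e\<close> the doubling map has the simple pole \<open>(t/4) / (x - e)\<close> with \<open>t = 3 e\<^sup>2 + a\<close>. Under the
  involution, which takes \<open>\<infinity>\<close> to \<open>e\<close>, its leading term at \<open>\<infinity>\<close> becomes \<open>(t / (4 s)) x\<close>; invariance means that
  this is \<open>x/4\<close>.\<close>

lemma doubling_involution:
  assumes "elliptic_curve a b" "e ^ 3 + a * e + b = 0" "s \<noteq> 0"
    "\<And>x. x \<noteq> e \<Longrightarrow> doubling a b (Fin (e + s / (x - e))) = doubling a b (Fin x)"
  shows "s = 3 * e ^ 2 + a"
proof -
  define t where "t = 3 * e ^ 2 + a"
  have "t \<noteq> 0" using elliptic_no_double_root[OF assms(1,2)] by (simp add: t_def)
  let ?S = "{x. x ^ 3 + a * x + b = 0}"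
  let ?N = "\<lambda>x. x ^ 4 - 2 * a * x ^ 2 - 8 * b * x + a ^ 2" and ?g = "\<lambda>y. 4 * s * (y ^ 2 + e * y + a + e ^ 2)"
  have "filterlim (\<lambda>x. x - e) at_infinity (at_infinity :: complex filter)"
    by (rule filterlim_shift)
  hence "((\<lambda>x. e + s * inverse (x - e)) \<longlongrightarrow> e + s * 0) at_infinity"
    by (intro tendsto_intros filterlim_compose[OF tendsto_inverse_0])
  hence y: "((\<lambda>x. e + s / (x - e)) \<longlongrightarrow> e) at_infinity" by (simp add: divide_inverse)
  have g: "?g e = 4 * s * t" by (simp add: t_def power2_eq_square)
  have "((\<lambda>x. ?N (e + s / (x - e)) / ?g (e + s / (x - e)) * (1 - e * inverse x)) \<longlongrightarrow>
      ?N e / ?g e * (1 - e * 0)) at_infinity"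
    by (intro tendsto_intros y) (use g \<open>t \<noteq> 0\<close> assms(3) in \<open>simp add: t_def\<close>)
  moreover have "?N e = t ^ 2" using assms(2) unfolding t_def by algebra
  ultimately have lim: "((\<lambda>x. ?N (e + s / (x - e)) / ?g (e + s / (x - e)) * (1 - e * inverse x)) \<longlongrightarrow>
      t ^ 2 / (4 * s * t)) at_infinity"
    unfolding g by simp
  have "\<forall>\<^sub>F x in at_infinity. ?N (e + s / (x - e)) / ?g (e + s / (x - e)) * (1 - e * inverse x) = affine_doubling a b x / x"
  proof (rule eventually_mono)
    show "\<forall>\<^sub>F x in at_infinity. x \<notin> {0, e} \<union> ?S"
      by (rule eventually_notin_finite) (simp add: finite_cubic_roots)
    fix x assume "x \<notin> {0, e} \<union> ?S"
    hence x: "x \<noteq> 0" "x \<noteq> e" "x ^ 3 + a * x + b \<noteq> 0" by auto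
    define y where "y = e + s / (x - e)"
    have ye: "(y - e) * (x - e) = s" using x by (simp add: y_def)
    have fy: "y ^ 3 + a * y + b = (y - e) * (y ^ 2 + e * y + a + e ^ 2)" using assms(2) by algebra
    have inv: "doubling a b (Fin y) = doubling a b (Fin x)" using assms(4)[OF x(2)] by (simp add: y_def)
    hence fy0: "y ^ 3 + a * y + b \<noteq> 0"
      using x(3) doubling_eq_Infty_iff by metis
    hence "affine_doubling a b x = affine_doubling a b y"
      using inv x(3) by (simp add: doubling_eq_affine_doubling)
    also have "\<dots> = ?N y / (4 * ((y - e) * (y ^ 2 + e * y + a + e ^ 2)))"
      unfolding affine_doubling_def fy ..
    also have "\<dots> = ?N y * (x - e) / (4 * ((y - e) * (x - e) * (y ^ 2 + e * y + a + e ^ 2)))"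
      using x(2) by (simp add: mult.assoc mult.left_commute[of _ "x - e"] mult.commute[of _ "x - e"])
    also have "\<dots> = ?N y / ?g y * (x - e)" unfolding ye by (simp add: mult.assoc)
    finally show "?N (e + s / (x - e)) / ?g (e + s / (x - e)) * (1 - e * inverse x) = affine_doubling a b x / x"
      unfolding y_def[symmetric] using x(1) by (simp add: field_simps)
  qed
  hence "((\<lambda>x. affine_doubling a b x / x) \<longlongrightarrow> t ^ 2 / (4 * s * t)) at_infinity"
    using lim by (rule Lim_transform_eventually[rotated])
  hence "t ^ 2 / (4 * s * t) = 1 / 4" by (rule affine_doubling_limit_unique)
  hence "t = s" using \<open>t \<noteq> 0\<close> assms(3) by (simp add: power2_eq_square)
  thus ?thesis by (simp add: t_def)
qed

section \<open>The j-invariant is determined by the Lattes map\<close>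

text \<open>If \<open>\<mu> Infty\<close> were a finite point \<open>m\<close>, it would be a fixed point of the second doubling map with
  the multiplier 4 of \<open>\<infinity>\<close>. But a finite fixed point is the x-coordinate of a point with \<open>2 P = - P\<close>, and its
  multiplier is \<open>- 2\<close>.\<close>

lemma conjugacy_fixes_Infty:
  assumes "morphism 1 \<mu>" "\<mu> \<circ> doubling a b = doubling a' b' \<circ> \<mu>"
  shows "\<mu> Infty = Infty"
proof (rule ccontr)
  assume "\<mu> Infty \<noteq> Infty"
  then obtain m where m: "\<mu> Infty = Fin m" by (cases "\<mu> Infty") auto
  obtain \<alpha> \<beta> \<gamma> \<delta> where det: "\<alpha> * \<delta> - \<beta> * \<gamma> \<noteq> 0" and \<mu>: "\<mu> = moebius \<alpha> \<beta> \<gamma> \<delta>"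
    using assms(1) by (rule morphism_1_moebius)
  have "\<gamma> \<noteq> 0" "m = \<alpha> / \<gamma>" using m \<mu> by (auto simp: cp1_of_def split: if_splits)
  hence \<alpha>: "\<alpha> = m * \<gamma>" by simp
  define d c where d: "d = - \<delta> / \<gamma>" and c: "c = (\<beta> - m * \<delta>) / \<gamma>"
  have \<delta>: "\<delta> = - d * \<gamma>" and \<beta>: "\<beta> = (c - m * d) * \<gamma>"
    using \<open>\<gamma> \<noteq> 0\<close> by (simp_all add: d c field_simps)
  have "c \<noteq> 0" using det unfolding \<alpha> \<delta> \<beta> by auto
  have \<mu>_Fin: "\<mu> (Fin z) = (if z = d then Infty else Fin (m + c / (z - d)))" for z
  proof -
    have "\<mu> (Fin z) = cp1_of (\<gamma> * (m * z + (c - m * d))) (\<gamma> * (z - d))"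
      unfolding \<mu> \<alpha> \<delta> \<beta> by (simp add: algebra_simps)
    also have "\<dots> = cp1_of (m * z + (c - m * d)) (z - d)" using \<open>\<gamma> \<noteq> 0\<close> by (rule cp1_of_scale)
    also have "m * z + (c - m * d) = m * (z - d) + c" by (simp add: algebra_simps)
    finally show ?thesis by (simp add: cp1_of_def add_divide_distrib)
  qed
  let ?f = "\<lambda>x. x ^ 3 + a' * x + b'"
  \<comment> \<open>\<open>?R\<close> is the quotient of \<open>N - 4 m f\<close> by \<open>x - m\<close>, where \<open>N\<close> is the numerator of the doubling map and
    \<open>4 f\<close> its denominator; the multiplier at \<open>m\<close> is \<open>?R m / (4 f(m))\<close>.\<close>
  let ?R = "\<lambda>x. (x ^ 3 + x ^ 2 * m + x * m ^ 2 + m ^ 3) - 2 * a' * (x + m) - 8 * b' - 4 * m * (x ^ 2 + x * m + m ^ 2 + a')"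
  have fixed: "doubling a' b' (Fin m) = Fin m" using fun_cong[OF assms(2), of Infty] m by simp
  hence fm: "?f m \<noteq> 0" using doubling_eq_Infty_iff[of a' b' m] by auto
  have "affine_doubling a' b' m = m" using fixed doubling_eq_affine_doubling[OF fm] by simp
  hence N: "m ^ 4 - 2 * a' * m ^ 2 - 8 * b' * m + a' ^ 2 = m * (4 * ?f m)"
    unfolding affine_doubling_def using fm by (simp add: nonzero_divide_eq_eq del: distrib_left_numeral)
  have dbl': "affine_doubling a' b' w = m + (w - m) * (?R w / (4 * ?f w))" if "?f w \<noteq> 0" for w
  proof -
    define q where "q = 4 * ?f w"
    have "q \<noteq> 0" unfolding q_def using that by (simp del: distrib_left_numeral)
    have "w ^ 4 - 2 * a' * w ^ 2 - 8 * b' * w + a' ^ 2 = m * q + (w - m) * ?R w"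
      unfolding q_def using N by algebra
    hence "affine_doubling a' b' w = (m * q + (w - m) * ?R w) / q" by (simp only: affine_doubling_def q_def)
    also have "\<dots> = m + (w - m) * (?R w / q)" using \<open>q \<noteq> 0\<close> by (simp add: add_divide_distrib)
    finally show ?thesis unfolding q_def .
  qed
  have Rm: "?R m / (4 * ?f m) = - 2"
  proof -
    have "?R m = - 2 * (4 * ?f m)" by algebra
    moreover have "4 * ?f m \<noteq> 0" using fm by (metis mult_eq_0_iff zero_neq_numeral)
    ultimately show ?thesis using nonzero_mult_div_cancel_right by metis
  qed
  have "filterlim (\<lambda>x. x - d) at_infinity (at_infinity :: complex filter)"
    by (rule filterlim_shift)
  hence "((\<lambda>x. m + c * inverse (x - d)) \<longlongrightarrow> m + c * 0) at_infinity"
    by (intro tendsto_intros filterlim_compose[OF tendsto_inverse_0])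
  hence w: "((\<lambda>x. m + c / (x - d)) \<longlongrightarrow> m) at_infinity" by (simp add: divide_inverse)
  have f_lim: "((\<lambda>x. ?f (m + c / (x - d))) \<longlongrightarrow> ?f m) at_infinity"
    by (intro tendsto_intros w)
  have R_lim: "((\<lambda>x. ?R (m + c / (x - d)) / (4 * ?f (m + c / (x - d)))) \<longlongrightarrow> ?R m / (4 * ?f m)) at_infinity"
    by (intro tendsto_intros w) (use fm in \<open>metis mult_eq_0_iff zero_neq_numeral\<close>)
  have D_lim: "((\<lambda>x. (affine_doubling a b x / x - d * inverse x) / (1 - d * inverse x)) \<longlongrightarrow> (1 / 4 - d * 0) / (1 - d * 0)) at_infinity"
    by (intro tendsto_intros affine_doubling_tendsto) simp
  \<comment> \<open>The product of the multiplier \<open>-2\<close> at \<open>m\<close> and the inverse \<open>1/4\<close> of the multiplier at \<open>\<infinity>\<close>; the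
    conjugacy forces it to be 1.\<close>
  have lim: "((\<lambda>x. ?R (m + c / (x - d)) / (4 * ?f (m + c / (x - d))) *
      ((affine_doubling a b x / x - d * inverse x) / (1 - d * inverse x))) \<longlongrightarrow> - 2 * ((1 / 4 - d * 0) / (1 - d * 0))) at_infinity"
    using tendsto_mult[OF R_lim D_lim] unfolding Rm .
  have "\<forall>\<^sub>F x in at_infinity. ?R (m + c / (x - d)) / (4 * ?f (m + c / (x - d))) *
      ((affine_doubling a b x / x - d * inverse x) / (1 - d * inverse x)) = 1"
  proof (rule eventually_mono)
    show "\<forall>\<^sub>F x in at_infinity. x \<notin> {0, d} \<union> {x. x ^ 3 + a * x + b = 0} \<and> ?f (m + c / (x - d)) \<noteq> 0"
      by (intro eventually_conj eventually_notin_finite tendsto_imp_eventually_ne[OF f_lim fm])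
        (simp add: finite_cubic_roots)
    fix x assume "x \<notin> {0, d} \<union> {x. x ^ 3 + a * x + b = 0} \<and> ?f (m + c / (x - d)) \<noteq> 0"
    hence x: "x \<noteq> 0" "x \<noteq> d" "x ^ 3 + a * x + b \<noteq> 0" and fw: "?f (m + c / (x - d)) \<noteq> 0" by auto
    define w where "w = m + c / (x - d)"
    have "\<mu> (doubling a b (Fin x)) = doubling a' b' (\<mu> (Fin x))"
      using fun_cong[OF assms(2), of "Fin x"] by simp
    hence "\<mu> (Fin (affine_doubling a b x)) = Fin (affine_doubling a' b' w)"
      using x fw by (simp add: doubling_eq_affine_doubling \<mu>_Fin w_def)
    hence Dd: "affine_doubling a b x \<noteq> d" and "m + c / (affine_doubling a b x - d) = affine_doubling a' b' w"
      by (auto simp: \<mu>_Fin split: if_splits)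
    moreover define Q where "Q = ?R w / (4 * ?f w)"
    moreover have "?f w \<noteq> 0" using fw by (simp only: w_def not_False_eq_True)
    ultimately have "c / (affine_doubling a b x - d) = (w - m) * Q" using dbl'[of w] by simp
    also have "w - m = c / (x - d)" by (simp add: w_def)
    also have "c / (x - d) * Q = c * Q / (x - d)" by simp
    finally have "c * (x - d) = c * Q * (affine_doubling a b x - d)"
      using Dd x(2) by (subst (asm) frac_eq_eq) simp_all
    hence "Q * (affine_doubling a b x - d) = x - d" using \<open>c \<noteq> 0\<close> by simp
    moreover have "(affine_doubling a b x / x - d * inverse x) / (1 - d * inverse x) = (affine_doubling a b x - d) / (x - d)"
      using x by (simp add: field_simps)
    ultimately have "Q * ((affine_doubling a b x / x - d * inverse x) / (1 - d * inverse x)) = (x - d) / (x - d)"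
      by (simp only: times_divide_eq_right)
    thus "?R (m + c / (x - d)) / (4 * ?f (m + c / (x - d))) *
      ((affine_doubling a b x / x - d * inverse x) / (1 - d * inverse x)) = 1"
      using x(2) unfolding w_def[symmetric] Q_def[symmetric] by simp
  qed
  hence "((\<lambda>x. ?R (m + c / (x - d)) / (4 * ?f (m + c / (x - d))) *
      ((affine_doubling a b x / x - d * inverse x) / (1 - d * inverse x))) \<longlongrightarrow> 1) at_infinity"
    by (rule tendsto_eventually)
  hence "1 = (- 2 :: complex) * ((1 / 4 - d * 0) / (1 - d * 0))"
    using lim by (rule tendsto_unique[OF at_infinity_neq_bot])
  hence "Re 1 = Re ((- 2 :: complex) * ((1 / 4 - d * 0) / (1 - d * 0)))" by (rule arg_cong)
  thus False by simp
qed

text \<open>The conjugacy fixes \<open>\<infinity>\<close>, so it is \<open>z \<mapsto> r z + k\<close> and preserves the fibre over \<open>\<infinity>\<close>: it maps the three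
  roots of one cubic to those of the other. Both triples have sum zero, which gives \<open>k = 0\<close>, and then
  \<open>a' = r\<^sup>2 a\<close> and \<open>b' = r\<^sup>3 b\<close>.\<close>

lemma conjugate_doublings_j_invariant:
  assumes "elliptic_curve a b" "elliptic_curve a' b'"
    "morphism 1 \<mu>" "\<mu> \<circ> doubling a b = doubling a' b' \<circ> \<mu>"
  shows "j_invariant a b = j_invariant a' b'"
proof -
  obtain \<alpha> \<beta> \<gamma> \<delta> where det: "\<alpha> * \<delta> - \<beta> * \<gamma> \<noteq> 0" and \<mu>: "\<mu> = moebius \<alpha> \<beta> \<gamma> \<delta>"
    using assms(3) by (rule morphism_1_moebius)
  have "\<gamma> = 0" using conjugacy_fixes_Infty[OF assms(3,4)] \<mu> by (simp add: cp1_of_def split: if_splits)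
  hence "\<alpha> \<noteq> 0" "\<delta> \<noteq> 0" using det by auto
  define r k where "r = \<alpha> / \<delta>" and "k = \<beta> / \<delta>"
  have "r \<noteq> 0" using \<open>\<alpha> \<noteq> 0\<close> \<open>\<delta> \<noteq> 0\<close> by (simp add: r_def)
  have \<mu>_Fin: "\<mu> (Fin z) = Fin (r * z + k)" for z
    using \<open>\<gamma> = 0\<close> \<open>\<delta> \<noteq> 0\<close> by (simp add: \<mu> cp1_of_def r_def k_def add_divide_distrib)
  obtain u1 u2 u3 where u: "u1 + u2 + u3 = - 0" "u1 * u2 + u1 * u3 + u2 * u3 = a" "u1 * u2 * u3 = - b"
    by (rule cubic_roots)
  have root: "(r * x + k) ^ 3 + a' * (r * x + k) + b' = 0" if "x ^ 3 + a * x + b = 0" for x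
  proof -
    have "doubling a' b' (\<mu> (Fin x)) = \<mu> (doubling a b (Fin x))"
      using fun_cong[OF assms(4), of "Fin x"] by simp
    also have "doubling a b (Fin x) = Infty" using that doubling_eq_Infty_iff by blast
    finally show ?thesis
      using conjugacy_fixes_Infty[OF assms(3,4)] doubling_eq_Infty_iff by (simp add: \<mu>_Fin)
  qed
  have roots: "u1 ^ 3 + a * u1 + b = 0" "u2 ^ 3 + a * u2 + b = 0" "u3 ^ 3 + a * u3 + b = 0"
    using u by algebra+
  have "3 * u1 ^ 2 + a = (u1 - u2) * (u1 - u3)" "3 * u2 ^ 2 + a = (u2 - u1) * (u2 - u3)"
    using u by algebra+
  hence dist: "u1 \<noteq> u2" "u1 \<noteq> u3" "u2 \<noteq> u3"
    using elliptic_no_double_root[OF assms(1)] roots by force+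
  define v1 v2 v3 where v: "v1 = r * u1 + k" "v2 = r * u2 + k" "v3 = r * u3 + k"
  have distv: "v1 - v2 \<noteq> 0" "v1 - v3 \<noteq> 0" "v2 - v3 \<noteq> 0" using dist \<open>r \<noteq> 0\<close> by (auto simp: v)
  have rv: "v1 ^ 3 + a' * v1 + b' = 0" "v2 ^ 3 + a' * v2 + b' = 0" "v3 ^ 3 + a' * v3 + b' = 0"
    unfolding v using root roots by blast+
  have "(v1 - v2) * (v1 ^ 2 + v1 * v2 + v2 ^ 2 + a') = 0" "(v1 - v3) * (v1 ^ 2 + v1 * v3 + v3 ^ 2 + a') = 0"
    using rv by algebra+
  hence q: "v1 ^ 2 + v1 * v2 + v2 ^ 2 + a' = 0" "v1 ^ 2 + v1 * v3 + v3 ^ 2 + a' = 0"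
    using distv by (metis mult_eq_0_iff)+
  hence "(v2 - v3) * (v1 + v2 + v3) = 0" by algebra
  hence sum: "v1 + v2 + v3 = 0" using distv by simp
  hence "3 * k = 0" using u(1) unfolding v by algebra
  hence "k = 0" by simp
  have a': "a' = r ^ 2 * a" using q(1) sum u(1,2) unfolding v \<open>k = 0\<close> by algebra
  have b': "b' = r ^ 3 * b" using rv(1) roots(1) unfolding v \<open>k = 0\<close> a' by algebra
  have "r ^ 6 \<noteq> 0" using \<open>r \<noteq> 0\<close> by simp
  have "j_invariant a' b' = (r ^ 6 * (1728 * (4 * a ^ 3))) / (r ^ 6 * (4 * a ^ 3 + 27 * b ^ 2))"
    unfolding j_invariant_def a' b' by (intro arg_cong2[of _ _ _ _ "(/)"]; algebra)
  also have "\<dots> = j_invariant a b"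
    unfolding j_invariant_def using \<open>r ^ 6 \<noteq> 0\<close> by (rule mult_divide_mult_cancel_left)
  finally show ?thesis ..
qed

lemma conjugate_eqI:
  assumes "bij K" "X \<circ> K = K \<circ> Y"
  shows "X = K \<circ> Y \<circ> inv K"
proof
  fix x
  have "X (K (inv K x)) = K (Y (inv K x))" using fun_cong[OF assms(2)] by simp
  thus "X x = (K \<circ> Y \<circ> inv K) x" using assms(1) by (simp add: bij_is_surj surj_f_inv_f)
qed

lemma lattes_mapI:
  assumes "elliptic_curve a b" "morphism 1 K" "X \<circ> K = K \<circ> doubling a b"
  shows "lattes_map (j_invariant a b) X"
  using conjugate_eqI[OF morphism_1_inv(1)[OF assms(2)] assms(3)]
    lattes_map_conjugate_doubling[OF assms(1,2)] by simp

lemma lattes_mapE: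
  assumes "lattes_map j L"
  obtains a b \<mu> where "elliptic_curve a b" "j = j_invariant a b" "morphism 1 \<mu>"
    "L \<circ> \<mu> = \<mu> \<circ> doubling a b" "bij \<mu>"
proof -
  obtain a b \<mu> where *: "elliptic_curve a b" "j_invariant a b = j" "morphism 1 \<mu>"
    "L = \<mu> \<circ> doubling a b \<circ> inv \<mu>"
    using assms by (rule lattes_map_conjugateE)
  have "L \<circ> \<mu> = \<mu> \<circ> doubling a b"
    using *(4) morphism_1_inv(1)[OF *(3)] by (auto simp: fun_eq_iff bij_is_inj)
  thus ?thesis using that * morphism_1_inv(1)[OF *(3)] by blast
qed

lemma lattes_map_j_unique:
  assumes "lattes_map j L" "lattes_map j' L"
  shows "j = j'"
proof -
  obtain a b \<mu> where 1: "elliptic_curve a b" "j = j_invariant a b" "morphism 1 \<mu>"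
    "L \<circ> \<mu> = \<mu> \<circ> doubling a b" "bij \<mu>"
    using assms(1) by (rule lattes_mapE)
  obtain a' b' \<nu> where 2: "elliptic_curve a' b'" "j' = j_invariant a' b'" "morphism 1 \<nu>"
    "L \<circ> \<nu> = \<nu> \<circ> doubling a' b'" "bij \<nu>"
    using assms(2) by (rule lattes_mapE)
  have "morphism (1 * 1) (inv \<nu> \<circ> \<mu>)"
    by (intro morphism_comp morphism_1_inv(2) 1 2)
  hence "morphism 1 (inv \<nu> \<circ> \<mu>)" by simp
  moreover have "(inv \<nu> \<circ> \<mu>) \<circ> doubling a b = doubling a' b' \<circ> (inv \<nu> \<circ> \<mu>)"
  proof
    fix x
    have "\<mu> (doubling a b x) = L (\<mu> x)" using fun_cong[OF 1(4), of x] by simp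
    also have "\<mu> x = \<nu> (inv \<nu> (\<mu> x))" using 2(5) by (simp add: bij_is_surj surj_f_inv_f)
    also have "L \<dots> = \<nu> (doubling a' b' (inv \<nu> (\<mu> x)))"
      using fun_cong[OF 2(4), of "inv \<nu> (\<mu> x)"] by simp
    finally show "((inv \<nu> \<circ> \<mu>) \<circ> doubling a b) x = (doubling a' b' \<circ> (inv \<nu> \<circ> \<mu>)) x"
      using 2(5) by (simp add: bij_is_inj)
  qed
  ultimately show ?thesis using conjugate_doublings_j_invariant 1 2 by blast
qed

section \<open>Decompositions of the doubling map\<close>

lemma poly_deg_2:
  fixes p :: "complex poly"
  assumes "degree p \<le> 2"
  shows "p = [:coeff p 0, coeff p 1, coeff p 2:]"
proof (rule poly_eqI)
  fix n :: nat
  consider "n = 0" | "n = 1" | "n = 2" | "n > 2" by linarith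
  thus "coeff p n = coeff [:coeff p 0, coeff p 1, coeff p 2:] n"
    by cases (use assms in \<open>auto simp: coeff_pCons coeff_eq_0 eval_nat_numeral split: nat.split\<close>)
qed

lemma quadratic_fixing_Infty:
  assumes "morphism 2 W" "W Infty = Infty"
  obtains p2 p1 p0 q1 q0 where "p2 \<noteq> 0"
    "\<And>z. W (Fin z) = cp1_of (p2 * z ^ 2 + p1 * z + p0) (q1 * z + q0)"
    "\<And>z. p2 * z ^ 2 + p1 * z + p0 \<noteq> 0 \<or> q1 * z + q0 \<noteq> 0"
proof -
  obtain p q where pq: "no_common_zero 2 p q" "W = hom_map 2 p q"
    using assms(1) by (auto simp: morphism_def)
  have q2: "coeff q 2 = 0" using assms(2) pq by (simp add: cp1_of_def split: if_splits)
  hence p2: "coeff p 2 \<noteq> 0" using pq(1) by (simp add: no_common_zero_def)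
  define p0 p1 p2 q0 q1 where d: "p0 = coeff p 0" "p1 = coeff p 1" "p2 = coeff p 2"
    "q0 = coeff q 0" "q1 = coeff q 1"
  have p: "p = [:p0, p1, p2:]" and q: "q = [:q0, q1, 0:]"
    unfolding d q2[symmetric] using pq(1) by (intro poly_deg_2; simp add: no_common_zero_def)+
  have pz: "poly p z = p2 * z ^ 2 + p1 * z + p0" and qz: "poly q z = q1 * z + q0" for z
    unfolding p q by (simp_all add: algebra_simps power2_eq_square)
  show ?thesis
    using that[of p2 p1 p0 q1 q0] \<open>coeff p 2 \<noteq> 0\<close> pq unfolding d(3)
    by (simp add: no_common_zero_def pz[unfolded d(3)] qz)
qed

text \<open>The Moebius transformation \<open>M\<close> moves \<open>V Infty\<close> to \<open>Infty\<close>, so that \<open>W = M \<circ> V\<close> is a quadratic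
  polynomial over a polynomial of degree at most one. A constant denominator would make the doubling
  map invariant under a reflection. Otherwise the pole \<open>e\<close> of \<open>W\<close> lies in the fibre of \<open>V\<close> through
  \<open>Infty\<close>, hence is a root of the cubic, and the deck involution of \<open>W\<close> has the form
  \<open>e + s / (z - e)\<close>; its invariance determines \<open>s\<close> and with it \<open>W\<close> up to an affine transformation.\<close>

lemma doubling_decomposition:
  assumes ab: "elliptic_curve a b" and D: "doubling a b = U \<circ> V" and U: "morphism 2 U" and V: "morphism 2 V"
  obtains e K where "e ^ 3 + a * e + b = 0" "morphism 1 K"
    "V = K \<circ> isogeny_x e (3 * e ^ 2 + a)" "U \<circ> K = dual_isogeny_x e (- 3 * e ^ 2 - 4 * a)"
proof -
  obtain M where M: "morphism 1 M" "M (V Infty) = Infty"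
  proof (cases "V Infty")
    case (Fin c)
    have "morphism 1 (moebius 0 1 1 (- c))" by (rule morphism_moebius) simp
    thus ?thesis using that[of "moebius 0 1 1 (- c)"] Fin by (simp add: cp1_of_def)
  next
    case Infty
    thus ?thesis using that[OF morphism_id] by simp
  qed
  note M_inv = morphism_1_inv[OF M(1)]
  define W where "W = M \<circ> V"
  have "morphism 2 W" using morphism_comp[OF M(1) V] by (simp add: W_def)
  moreover have "W Infty = Infty" using M(2) by (simp add: W_def)
  ultimately obtain p2 p1 p0 q1 q0 where p2: "p2 \<noteq> 0"
    and W: "\<And>z. W (Fin z) = cp1_of (p2 * z ^ 2 + p1 * z + p0) (q1 * z + q0)"
    and nz: "\<And>z. p2 * z ^ 2 + p1 * z + p0 \<noteq> 0 \<or> q1 * z + q0 \<noteq> 0"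
    by (rule quadratic_fixing_Infty) blast
  have fibre: "doubling a b x = doubling a b y" if "W x = W y" for x y
  proof -
    have "V x = V y" using that M_inv(1) by (auto simp: W_def bij_def inj_def)
    thus ?thesis using D by simp
  qed
  have "q1 \<noteq> 0"
  proof
    assume "q1 = 0"
    \<comment> \<open>A quadratic polynomial is symmetric about its critical point \<open>- p1 / (2 p2)\<close>.\<close>
    have "p2 * (- p1 / p2 - z) ^ 2 + p1 * (- p1 / p2 - z) + p0 = p2 * z ^ 2 + p1 * z + p0" for z
    proof -
      define c where "c = - p1 / p2"
      have p1: "p1 = - c * p2" using p2 by (simp add: c_def)
      show ?thesis unfolding c_def[symmetric] unfolding p1 by algebra
    qed
    hence "W (Fin (- p1 / p2 - z)) = W (Fin z)" for z
      unfolding W \<open>q1 = 0\<close> by simp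
    thus False using doubling_not_reflection_invariant[of a b "- p1 / p2"] fibre by blast
  qed
  define e k r where "e = - q0 / q1" and "k = p1 + 2 * p2 * e" and "r = p2 * e ^ 2 + p1 * e + p0"
  have q0: "q0 = - e * q1" and p1: "p1 = k - 2 * p2 * e" and p0: "p0 = r - p2 * e ^ 2 - p1 * e"
    using \<open>q1 \<noteq> 0\<close> by (simp_all add: e_def k_def r_def)
  have "r \<noteq> 0" using nz[of e] unfolding q0 r_def by simp
  have W': "W (Fin z) = cp1_of (p2 * (z - e) ^ 2 + k * (z - e) + r) (q1 * (z - e))" for z
    unfolding W q0 p0 p1 by (intro arg_cong2[of _ _ _ _ cp1_of]; algebra)
  have root: "e ^ 3 + a * e + b = 0"
  proof -
    have "W (Fin e) = W Infty" using \<open>W Infty = Infty\<close> by (simp add: W' cp1_of_def)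
    hence "doubling a b (Fin e) = Infty" using fibre[of "Fin e" Infty] by simp
    thus ?thesis by (simp only: doubling_eq_Infty_iff)
  qed
  define t where "t = 3 * e ^ 2 + a"
  have "r / p2 = t"
    unfolding t_def
  proof (rule doubling_involution[OF ab root])
    show "r / p2 \<noteq> 0" using \<open>r \<noteq> 0\<close> p2 by simp
    fix x assume "x \<noteq> e"
    \<comment> \<open>In terms of \<open>X = x - e\<close> the map \<open>W\<close> is proportional to \<open>p2 X + k + r / X\<close>, which is
      symmetric in \<open>X\<close> and \<open>r / (p2 X)\<close>.\<close>
    define X Y where "X = x - e" and "Y = r / p2 / X"
    have "X \<noteq> 0" "Y \<noteq> 0" using \<open>x \<noteq> e\<close> \<open>r \<noteq> 0\<close> p2 by (auto simp: X_def Y_def)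
    have r: "r = p2 * X * Y" using \<open>X \<noteq> 0\<close> p2 by (simp add: Y_def)
    have "W (Fin (e + Y)) = cp1_of (Y * (p2 * Y + k + p2 * X)) (Y * q1)"
      unfolding W' r by (intro arg_cong2[of _ _ _ _ cp1_of]; algebra)
    also have "\<dots> = cp1_of (p2 * Y + k + p2 * X) q1"
      using \<open>Y \<noteq> 0\<close> by (rule cp1_of_scale)
    also have "\<dots> = cp1_of (X * (p2 * Y + k + p2 * X)) (X * q1)"
      using \<open>X \<noteq> 0\<close> by (rule cp1_of_scale[symmetric])
    also have "\<dots> = W (Fin x)"
      unfolding W' r X_def[symmetric] by (intro arg_cong2[of _ _ _ _ cp1_of]; algebra)
    finally show "doubling a b (Fin (e + r / p2 / (x - e))) = doubling a b (Fin x)"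
      unfolding X_def[symmetric] Y_def[symmetric] by (rule fibre)
  qed
  hence r: "r = p2 * t" using p2 by (simp add: field_simps)
  have "t \<noteq> 0" using r \<open>r \<noteq> 0\<close> by auto
  define A where "A = moebius p2 (k - p2 * e) 0 q1"
  have A: "morphism 1 A" unfolding A_def using p2 \<open>q1 \<noteq> 0\<close> by (intro morphism_moebius) simp
  have "W x = A (isogeny_x e t x)" for x
  proof (cases x)
    case (Fin z)
    have nz: "z ^ 2 - e * z + t \<noteq> 0 \<or> z - e \<noteq> 0"
      using \<open>t \<noteq> 0\<close> by (auto simp: power2_eq_square)
    show ?thesis unfolding Fin W' isogeny_x_simps A_def moebius_cp1_of[OF nz] r
      by (intro arg_cong2[of _ _ _ _ cp1_of]; algebra)
  next
    case Infty
    thus ?thesis using \<open>W Infty = Infty\<close> by (simp add: A_def isogeny_x_simps cp1_of_def)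
  qed
  hence W_eq: "W = A \<circ> isogeny_x e t" by auto
  define K where "K = inv M \<circ> A"
  have K: "morphism 1 K" using morphism_comp[OF M_inv(2) A] by (simp add: K_def)
  have VK: "V = K \<circ> isogeny_x e t"
  proof -
    have "inv M \<circ> W = V" using M_inv(1) by (auto simp: W_def bij_is_inj)
    thus ?thesis unfolding W_eq K_def by (simp add: comp_assoc)
  qed
  have "U \<circ> K = dual_isogeny_x e (- 3 * e ^ 2 - 4 * a)"
  proof
    fix y
    obtain x where x: "y = isogeny_x e t x"
      using morphism_surj[OF morphism_isogeny_x[OF \<open>t \<noteq> 0\<close>, of e]] by (metis surjE zero_less_numeral)
    have "U (K y) = doubling a b x" unfolding x D VK by simp
    also have "\<dots> = dual_isogeny_x e (- 3 * e ^ 2 - 4 * a) y"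
      unfolding doubling_factor(1)[OF ab root] x t_def by simp
    finally show "(U \<circ> K) y = dual_isogeny_x e (- 3 * e ^ 2 - 4 * a) y" by simp
  qed
  thus ?thesis using that root K VK unfolding t_def by blast
qed

lemma lattes_map_morphism:
  assumes "lattes_map j L"
  shows "morphism 4 L"
proof -
  obtain a b \<mu> where *: "elliptic_curve a b" "j_invariant a b = j" "morphism 1 \<mu>"
    "L = \<mu> \<circ> doubling a b \<circ> inv \<mu>"
    using assms by (rule lattes_map_conjugateE)
  have "morphism (1 * 4 * 1) L"
    unfolding *(4) by (intro morphism_comp morphism_doubling morphism_1_inv *)
  thus ?thesis by simp
qed

text \<open>If \<open>U\<close> or \<open>V\<close> has degree one, \<open>V \<circ> U\<close> is conjugate to \<open>U \<circ> V\<close>. If both have degree two, they are an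
  isogeny and its dual up to Moebius transformations, and \<open>V \<circ> U\<close> is conjugate to the doubling map of
  the isogenous curve.\<close>

lemma elementary_transformation_lattes:
  assumes "lattes_map j L" "elementary_transformation L B"
  obtains j' where "lattes_map j' B" "j' = j \<or> Phi2 j j' = 0"
proof -
  obtain U V where UV: "rational_function U" "rational_function V" "L = U \<circ> V" "B = V \<circ> U"
    using assms(2) unfolding elementary_transformation_def by blast
  obtain m n where mn: "morphism m U" "morphism n V"
    using UV(1,2) rational_function_iff_morphism by blast
  obtain a b \<mu> where ab: "elliptic_curve a b" and j: "j = j_invariant a b" and \<mu>: "morphism 1 \<mu>"
    and L: "L \<circ> \<mu> = \<mu> \<circ> doubling a b" and bij: "bij \<mu>"
    using assms(1) by (rule lattes_mapE)
  have UV\<mu>: "U (V (\<mu> x)) = \<mu> (doubling a b x)" for x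
    using fun_cong[OF L, of x] UV(3) by simp
  have "m * n = 4"
    using morphism_degree_unique[OF morphism_comp[OF mn] ] lattes_map_morphism[OF assms(1)] UV(3) by simp
  have "m dvd 4" using \<open>m * n = 4\<close> by (metis dvd_triv_left)
  hence "m \<in> {1, 2, 4}"
  proof -
    have "m \<le> 4" using \<open>m dvd 4\<close> by (rule dvd_imp_le) simp
    hence "m = 0 \<or> m = 1 \<or> m = 2 \<or> m = 3 \<or> m = 4" by linarith
    thus ?thesis using \<open>m * n = 4\<close> by auto presburger
  qed
  then consider "m = 1" | "n = 1" | "m = 2" "n = 2" using \<open>m * n = 4\<close> by auto
  thus ?thesis
  proof cases
    case 1
    hence U: "morphism 1 U" using mn by simp
    note U_inv = morphism_1_inv[OF U]
    have "morphism 1 (inv U \<circ> \<mu>)" using morphism_comp[OF U_inv(2) \<mu>] by simp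
    moreover have "B \<circ> (inv U \<circ> \<mu>) = (inv U \<circ> \<mu>) \<circ> doubling a b"
    proof
      fix x
      have "inv U (\<mu> (doubling a b x)) = V (\<mu> x)"
        unfolding UV\<mu>[symmetric] using U_inv(1) by (simp add: bij_is_inj)
      thus "(B \<circ> (inv U \<circ> \<mu>)) x = ((inv U \<circ> \<mu>) \<circ> doubling a b) x"
        unfolding UV(4) using U_inv(1) by (simp add: bij_is_surj surj_f_inv_f)
    qed
    ultimately have "lattes_map j B" unfolding j by (rule lattes_mapI[OF ab])
    thus ?thesis using that by blast
  next
    case 2
    have "morphism 1 (V \<circ> \<mu>)" using morphism_comp[OF mn(2) \<mu>] 2 by simp
    moreover have "B \<circ> (V \<circ> \<mu>) = (V \<circ> \<mu>) \<circ> doubling a b"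
      unfolding UV(4) by (auto simp: UV\<mu>)
    ultimately have "lattes_map j B" unfolding j by (rule lattes_mapI[OF ab])
    thus ?thesis using that by blast
  next
    case 3
    define U1 V1 where "U1 = inv \<mu> \<circ> U" and "V1 = V \<circ> \<mu>"
    have "doubling a b = U1 \<circ> V1"
      using bij by (auto simp: U1_def V1_def UV\<mu> bij_is_inj)
    moreover have "morphism 2 U1" "morphism 2 V1"
      using morphism_comp[OF morphism_1_inv(2)[OF \<mu>] mn(1)] morphism_comp[OF mn(2) \<mu>] 3
      by (simp_all add: U1_def V1_def)
    ultimately obtain e K where e: "e ^ 3 + a * e + b = 0" and K: "morphism 1 K"
      and VK: "V1 = K \<circ> isogeny_x e (3 * e ^ 2 + a)"
      and UK: "U1 \<circ> K = dual_isogeny_x e (- 3 * e ^ 2 - 4 * a)"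
      by (rule doubling_decomposition[OF ab])
    note iso = isogenous_j_invariants[OF ab e]
    have "V1 \<circ> U1 = B"
      using bij by (auto simp: U1_def V1_def UV(4) bij_is_surj surj_f_inv_f)
    hence "B \<circ> K = V1 \<circ> (U1 \<circ> K)" by auto
    also have "\<dots> = K \<circ> doubling (isogenous_a a e) (isogenous_b a e)"
      unfolding UK VK doubling_factor(2)[OF ab e] by (simp add: comp_assoc)
    finally have "lattes_map (j_invariant (isogenous_a a e) (isogenous_b a e)) B"
      by (rule lattes_mapI[OF iso(1) K])
    moreover have "Phi2 j (j_invariant (isogenous_a a e) (isogenous_b a e)) = 0"
      unfolding j iso(3,4) by (rule modular_parametrization[OF iso(2)])
    ultimately show ?thesis using that by blast
  qed
qed

section \<open>Equivalence classes and orbits\<close>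

lemma elementary_transformation_sym:
  "elementary_transformation A B \<Longrightarrow> elementary_transformation B A"
  unfolding elementary_transformation_def by blast

lemma equivalent_rat_sym: "A \<sim>\<^sub>r B \<Longrightarrow> B \<sim>\<^sub>r A"
  using symp_rtranclp[of elementary_transformation] elementary_transformation_sym
  unfolding equivalent_rat_def symp_def by blast

lemma lattes_map_ex: "\<exists>L. lattes_map j L"
proof -
  obtain y where "Phi2 j y = 0" using Phi2_ex by blast
  then obtain h where h: "h \<noteq> 0" "j = 256 * (h - 1) ^ 3 / h"
    unfolding Phi2_eq_0_iff by blast
  obtain a b e where ab: "elliptic_curve a b" "e ^ 3 + a * e + b = 0"
    "(3 * e ^ 2 + 4 * a) / (3 * e ^ 2 + a) = h"
    using h(1) by (rule curve_with_parameter)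
  have "j_invariant a b = j" using isogenous_j_invariants(3)[OF ab(1,2)] ab(3) h(2) by simp
  thus ?thesis using lattes_map_conjugate_doubling[OF ab(1) morphism_id] by blast
qed

text \<open>The curves are related by a scaling \<open>S\<close>, so the maps are conjugate by some Moebius transformation
  \<open>K\<close>. A conjugacy is the elementary transformation of \<open>L = (inv K \<circ> L') \<circ> K\<close>.\<close>

lemma lattes_maps_same_j:
  assumes "lattes_map j L" "lattes_map j L'"
  shows "elementary_transformation L L'"
proof -
  obtain a b \<mu> where 1: "elliptic_curve a b" "j = j_invariant a b" "morphism 1 \<mu>"
    "L \<circ> \<mu> = \<mu> \<circ> doubling a b" "bij \<mu>"
    using assms(1) by (rule lattes_mapE)
  obtain a' b' \<nu> where 2: "elliptic_curve a' b'" "j = j_invariant a' b'" "morphism 1 \<nu>"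
    "L' \<circ> \<nu> = \<nu> \<circ> doubling a' b'" "bij \<nu>"
    using assms(2) by (rule lattes_mapE)
  obtain r where r: "r \<noteq> 0" "a' = r ^ 2 * a" "b' = r ^ 3 * b"
    using 1(1) 2(1) 1(2)[symmetric, unfolded 2(2)] by (rule isomorphic_curves)
  define S where "S = moebius r 0 0 1"
  have S: "morphism 1 S" unfolding S_def using r(1) by (intro morphism_moebius) simp
  have S_dbl: "S (doubling a b x) = doubling a' b' (S x)" for x
  proof (cases x)
    case (Fin z)
    let ?n = "z ^ 4 - 2 * a * z ^ 2 - 8 * b * z + a ^ 2" and ?d = "4 * (z ^ 3 + a * z + b)"
    have nz: "?n \<noteq> 0 \<or> ?d \<noteq> 0"
      using doubling_numerator_nonzero[OF 1(1), of z] by (metis mult_eq_0_iff zero_neq_numeral)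
    have "S (doubling a b x) = cp1_of (r * ?n) ?d"
      unfolding Fin doubling_Fin S_def moebius_cp1_of[OF nz] by simp
    also have "\<dots> = cp1_of (r ^ 3 * (r * ?n)) (r ^ 3 * ?d)"
      using r(1) by (intro cp1_of_scale[symmetric]) simp
    also have "\<dots> = doubling a' b' (Fin (r * z))"
      unfolding doubling_Fin r by (intro arg_cong2[of _ _ _ _ cp1_of]; algebra)
    finally show ?thesis using Fin by (simp add: S_def cp1_of_def)
  qed (simp add: S_def cp1_of_def)
  define K where "K = \<nu> \<circ> S \<circ> inv \<mu>"
  have "morphism (1 * 1 * 1) K"
    unfolding K_def by (intro morphism_comp morphism_1_inv(2) 1 2 S)
  hence K: "morphism 1 K" by simp
  note K_inv = morphism_1_inv[OF K]
  have conj: "L' (K x) = K (L x)" for x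
  proof -
    define z where "z = inv \<mu> x"
    have x: "x = \<mu> z" using 1(5) by (simp add: z_def bij_is_surj surj_f_inv_f)
    have K_\<mu>: "K (\<mu> y) = \<nu> (S y)" for y using 1(5) by (simp add: K_def bij_is_inj)
    have "L' (K x) = \<nu> (doubling a' b' (S z))"
      unfolding x K_\<mu> using fun_cong[OF 2(4), of "S z"] by simp
    also have "\<dots> = K (L x)"
      unfolding x using fun_cong[OF 1(4), of z] by (simp add: K_\<mu> S_dbl)
    finally show ?thesis .
  qed
  have rat: "rational_function L" "rational_function L'"
    using assms by (auto simp: lattes_map_def)
  have "morphism 4 (inv K \<circ> L')"
    using morphism_comp[OF K_inv(2) lattes_map_morphism[OF assms(2)]] by simp
  hence "rational_function (inv K \<circ> L')" "rational_function K"
    using K by (auto intro: morphism_imp_rational_function)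
  moreover have "L = (inv K \<circ> L') \<circ> K" using K_inv(1) by (auto simp: conj bij_is_inj)
  moreover have "L' = K \<circ> (inv K \<circ> L')"
    using K_inv(1) by (auto simp: bij_is_surj surj_f_inv_f)
  ultimately show ?thesis using rat unfolding elementary_transformation_def by blast
qed

text \<open>The parameter \<open>h\<close> of the pair of invariants is realized by a curve with a root \<open>e\<close>; the
  decomposition of its doubling map through the isogeny joins the two invariants.\<close>

lemma lattes_maps_modular_neighbours:
  assumes "lattes_map j L" "lattes_map j' L'" "Phi2 j j' = 0"
  shows "elementary_transformation\<^sup>*\<^sup>* L L'"
proof -
  obtain h where h: "h \<noteq> 0" "j = 256 * (h - 1) ^ 3 / h" "j' = 16 * (16 - h) ^ 3 / h ^ 2"
    using assms(3) unfolding Phi2_eq_0_iff by blast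
  obtain a b e where ab: "elliptic_curve a b" "e ^ 3 + a * e + b = 0"
    "(3 * e ^ 2 + 4 * a) / (3 * e ^ 2 + a) = h"
    using h(1) by (rule curve_with_parameter)
  note iso = isogenous_j_invariants[OF ab(1,2), unfolded ab(3)]
  let ?D = "doubling a b" and ?D' = "doubling (isogenous_a a e) (isogenous_b a e)"
  let ?V = "isogeny_x e (3 * e ^ 2 + a)" and ?U = "dual_isogeny_x e (- 3 * e ^ 2 - 4 * a)"
  have lat: "lattes_map j ?D" "lattes_map j' ?D'"
    using lattes_map_conjugate_doubling[OF ab(1) morphism_id]
      lattes_map_conjugate_doubling[OF iso(1) morphism_id] iso h by simp_all
  define t s where "t = 3 * e ^ 2 + a" and "s = 3 * e ^ 2 + 4 * a"
  have "t \<noteq> 0" "s \<noteq> 0" using ab(3) h(1) unfolding t_def[symmetric] s_def[symmetric] by auto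
  moreover have "- 3 * e ^ 2 - 4 * a = - s" by (simp add: s_def)
  ultimately have "rational_function ?U" "rational_function ?V"
    unfolding t_def[symmetric]
    by (simp_all add: morphism_imp_rational_function[OF morphism_dual_isogeny_x] morphism_imp_rational_function[OF morphism_isogeny_x])
  hence "elementary_transformation ?D ?D'"
    using doubling_factor[OF ab(1,2)] lat unfolding elementary_transformation_def lattes_map_def by blast
  moreover have "elementary_transformation L ?D" "elementary_transformation ?D' L'"
    using lattes_maps_same_j assms lat by blast+
  ultimately show ?thesis by (meson converse_rtranclp_into_rtranclp r_into_rtranclp)
qed

lemma iterated_image_Suc:
  "iterated_image F (Suc k) x z \<longleftrightarrow> (\<exists>y. iterated_image F k x y \<and> F y z = 0)"
proof
  assume "iterated_image F (Suc k) x z"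
  then obtain u where u: "u 0 = x" "u (Suc k) = z" "\<forall>i\<in>{1..Suc k}. F (u (i - 1)) (u i) = 0"
    unfolding iterated_image_def by blast
  have "iterated_image F k x (u k)" unfolding iterated_image_def using u by (intro exI[of _ u]) auto
  moreover have "F (u k) z = 0" using u(2) u(3)[rule_format, of "Suc k"] by simp
  ultimately show "\<exists>y. iterated_image F k x y \<and> F y z = 0" by blast
next
  assume "\<exists>y. iterated_image F k x y \<and> F y z = 0"
  then obtain u where u: "u 0 = x" "F (u k) z = 0" "\<forall>i\<in>{1..k}. F (u (i - 1)) (u i) = 0"
    unfolding iterated_image_def by blast
  show "iterated_image F (Suc k) x z"
    unfolding iterated_image_def
  proof (intro exI[of _ "u(Suc k := z)"] conjI ballI)
    fix i assume "i \<in> {1..Suc k}"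
    hence "i = Suc k \<or> i \<in> {1..k}" by auto
    thus "F ((u(Suc k := z)) (i - 1)) ((u(Suc k := z)) i) = 0" using u by auto
  qed (use u in auto)
qed

text \<open>Orbits are defined by paths of positive length; \<open>j\<close> itself is reached by stepping to a neighbour and
  back, as the correspondence is total and symmetric.\<close>

lemma orbit_Phi2: "orbit Phi2 j = {j'. (\<lambda>x y. Phi2 x y = 0)\<^sup>*\<^sup>* j j'}"
proof (intro equalityI subsetI; clarify?)
  fix j' assume "j' \<in> orbit Phi2 j"
  then obtain k where "iterated_image Phi2 k j j'" by (auto simp: orbit_def)
  thus "(\<lambda>x y. Phi2 x y = 0)\<^sup>*\<^sup>* j j'"
  proof (induction k arbitrary: j')
    case 0
    thus ?case by (auto simp: iterated_image_def)
  next
    case (Suc k)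
    thus ?case unfolding iterated_image_Suc by (meson rtranclp.rtrancl_into_rtrancl)
  qed
next
  fix j' assume "(\<lambda>x y. Phi2 x y = 0)\<^sup>*\<^sup>* j j'"
  thus "j' \<in> orbit Phi2 j"
  proof (induction rule: rtranclp_induct)
    case base
    obtain y where "Phi2 j y = 0" using Phi2_ex by blast
    moreover have "Phi2 y j = 0" using calculation Phi2_sym by simp
    moreover have "iterated_image Phi2 0 j j" by (auto simp: iterated_image_def)
    ultimately have "iterated_image Phi2 (Suc (Suc 0)) j j" unfolding iterated_image_Suc by blast
    thus ?case unfolding orbit_def by (intro CollectI exI[of _ "Suc (Suc 0)"]) simp
  next
    case (step y z)
    then obtain k where "k \<ge> 1" "iterated_image Phi2 k j y" by (auto simp: orbit_def)
    hence "iterated_image Phi2 (Suc k) j z" using step(2) iterated_image_Suc by blast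
    thus ?case unfolding orbit_def by (intro CollectI exI[of _ "Suc k"]) simp
  qed
qed

text \<open>Each elementary transformation in the chain is one step of the correspondence or none.\<close>

lemma equivalent_lattes_map:
  assumes "lattes_map j L" "elementary_transformation\<^sup>*\<^sup>* L B"
  shows "\<exists>j'. lattes_map j' B \<and> j' \<in> orbit Phi2 j"
  using assms(2)
proof (induction rule: rtranclp_induct)
  case base
  thus ?case using assms(1) by (auto simp: orbit_Phi2)
next
  case (step B C)
  then obtain j1 where j1: "lattes_map j1 B" "(\<lambda>x y. Phi2 x y = 0)\<^sup>*\<^sup>* j j1"
    by (auto simp: orbit_Phi2)
  obtain j2 where "lattes_map j2 C" "j2 = j1 \<or> Phi2 j1 j2 = 0"
    using j1(1) step(2) by (rule elementary_transformation_lattes)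
  thus ?case using j1(2) unfolding orbit_Phi2
    by (auto intro: rtranclp.rtrancl_into_rtrancl)
qed

lemma orbit_lattes_map_equivalent:
  assumes "lattes_map j L" "lattes_map j' L'" "j' \<in> orbit Phi2 j"
  shows "L \<sim>\<^sub>r L'"
proof -
  have "(\<lambda>x y. Phi2 x y = 0)\<^sup>*\<^sup>* j j'" using assms(3) by (simp add: orbit_Phi2)
  hence "elementary_transformation\<^sup>*\<^sup>* L L'" using assms(2)
  proof (induction arbitrary: L' rule: rtranclp_induct)
    case base
    thus ?case using lattes_maps_same_j[OF assms(1)] by blast
  next
    case (step y z)
    obtain M where M: "lattes_map y M" using lattes_map_ex by blast
    show ?case
      using step.IH[OF M] lattes_maps_modular_neighbours[OF M step.prems step.hyps(2)] by simp
  qed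
  thus ?thesis using assms by (simp add: equivalent_rat_def lattes_map_def)
qed

theorem theorem1p2:
  fixes j :: complex and L :: "cp1 \<Rightarrow> cp1"
  assumes "lattes_map j L"
  shows "(\<forall>B. B \<sim>\<^sub>r L \<longrightarrow> (\<exists>j'. lattes_map j' B))
       \<and> {j'. \<exists>L'. lattes_map j' L' \<and> L' \<sim>\<^sub>r L} = orbit Phi2 j
       \<and> {j'. \<forall>L'. lattes_map j' L' \<longrightarrow> L' \<sim>\<^sub>r L} = orbit Phi2 j"
proof -
  have lattes: "\<exists>j'. lattes_map j' B \<and> j' \<in> orbit Phi2 j" if "B \<sim>\<^sub>r L" for B
    using equivalent_lattes_map[OF assms] equivalent_rat_sym[OF that] by (simp add: equivalent_rat_def)
  have in_orbit: "j' \<in> orbit Phi2 j" if "lattes_map j' L'" "L' \<sim>\<^sub>r L" for j' L'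
    using lattes[OF that(2)] lattes_map_j_unique[OF that(1)] by blast
  have equiv: "L' \<sim>\<^sub>r L" if "j' \<in> orbit Phi2 j" "lattes_map j' L'" for j' L'
    using orbit_lattes_map_equivalent[OF assms that(2,1)] by (rule equivalent_rat_sym)
  show ?thesis
    using lattes in_orbit equiv lattes_map_ex by blast
qed

end
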